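(* Every Lie super-bialgebra structure $(\mathfrak{L},[\cdot,\cdot],\Delta)$ on the generalized super $W$-algebra $\mathfrak{L}$ is triangular coboundary. That is, there exists $r\in\mathrm{Im}(1\otimes1-\tau)\subset\mathfrak{L}\otimes\mathfrak{L}$ such that: - $\Delta(x)=(-1)^{[r][x]}x\circ r$ for all $x\in\mathfrak{L}$, and - $r$ satisfies the classical Yang–Baxter equation $c(r)=0$.
   Context: Let $\Gamma$ be a nontrivial additive subgroup of $\mathbb{R}$, and let $s\in\mathbb{R}$ with $2s\in\Gamma$. The Lie superalgebra $\mathfrak{L}$ over $\mathbb{C}$ has basis $\{L_p,I_p,G_r,H_r\mid p\in\Gamma,\ r\in s+\Gamma\}$. Here $L_p,I_p$ are even and $G_r,H_r$ are odd. The nonzero super-brackets are $[L_p,L_q]=(p-q)L_{p+q}$, $[L_p,I_q]=(p-q)I_{p+q}$, $[L_p,G_r]=(\tfrac p2-r)G_{p+r}$, $[L_p,H_r]=(\tfrac p2-r)H_{p+r}$, $[G_r,G_t]=I_{r+t}$, $[I_p,G_r]=(p-2r)H_{p+r}$. All other brackets of basis elements vanish, apart from those forced by super-antisymmetry. Conventions: - $[x]\in\mathbb{Z}_2$ is the parity of a homogeneous $x$. - $\tau(x\otimes y)=(-1)^{[x][y]}y\otimes x$ is the super-twist. - $\xi(x_1\otimes x_2\otimes x_3)=(-1)^{[x_1]([x_2]+[x_3])}x_2\otimes x_3\otimes x_1$ is the super-cyclic map. - The adjoint diagonal action is $x\circ(a\otimes b)=[x,a]\otimes b+(-1)^{[x][a]}a\otimes[x,b]$.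 A Lie super-coalgebra structure is a linear map $\Delta:\mathfrak{L}\to\mathfrak{L}\otimes\mathfrak{L}$ satisfying: - $\Delta$ preserves parity, - $\mathrm{Im}\Delta\subset\mathrm{Im}(1\otimes1-\tau)$, - $(1\otimes1\otimes1+\xi+\xi^2)(1\otimes\Delta)\Delta=0$. A Lie super-bialgebra structure additionally requires $\Delta([x,y])=x\circ\Delta(y)-(-1)^{[x][y]}y\circ\Delta(x)$ for all homogeneous $x,y$. For $r=\sum_i a_i\otimes b_i$ with homogeneous $a_i,b_i$, define $c(r)=\sum_{i,j}\Big((-1)^{[a_j][b_i]}[a_i,a_j]\otimes b_i\otimes b_j+a_i\otimes[b_i,a_j]\otimes b_j+(-1)^{[a_j][b_i]}a_i\otimes a_j\otimes[b_i,b_j]\Big)\in\mathfrak{L}^{\otimes3}$. The equation $c(r)=0$ is the classical Yang–Baxter equation. *)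

theory Defs
  imports Complex_Main
begin

text \<open>Basis labels of the generalized super W-algebra:
  Lb p = L_p, Ib p = I_p (even), Gb r = G_r, Hb r = H_r (odd).
  Vectors are finitely supported coefficient functions lbl => complex;
  elements of L (x) L are functions on pairs, elements of L^(x)3 functions on triples.\<close>

datatype lbl = Lb real | Ib real | Gb real | Hb real

definition spt :: "('a \<Rightarrow> complex) \<Rightarrow> 'a set" where
  "spt f = {x. f x \<noteq> 0}"

fun par :: "lbl \<Rightarrow> nat" where
  "par (Lb _) = 0" | "par (Ib _) = 0" | "par (Gb _) = 1" | "par (Hb _) = 1"

definition ssign :: "lbl \<Rightarrow> lbl \<Rightarrow> complex" where
  "ssign a b = (-1) ^ (par a * par b)"

definition bv :: "lbl \<Rightarrow> lbl \<Rightarrow> complex" where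
  "bv a = (\<lambda>x. if x = a then 1 else 0)"

definition smul :: "complex \<Rightarrow> ('a \<Rightarrow> complex) \<Rightarrow> 'a \<Rightarrow> complex" where
  "smul c f = (\<lambda>x. c * f x)"

text \<open>Bracket of basis elements (including the brackets forced by super-antisymmetry).\<close>
fun br :: "lbl \<Rightarrow> lbl \<Rightarrow> lbl \<Rightarrow> complex" where
  "br (Lb p) (Lb q) = smul (of_real (p - q)) (bv (Lb (p + q)))"
| "br (Lb p) (Ib q) = smul (of_real (p - q)) (bv (Ib (p + q)))"
| "br (Ib q) (Lb p) = smul (- of_real (p - q)) (bv (Ib (p + q)))"
| "br (Lb p) (Gb r) = smul (of_real (p / 2 - r)) (bv (Gb (p + r)))"
| "br (Gb r) (Lb p) = smul (- of_real (p / 2 - r)) (bv (Gb (p + r)))"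
| "br (Lb p) (Hb r) = smul (of_real (p / 2 - r)) (bv (Hb (p + r)))"
| "br (Hb r) (Lb p) = smul (- of_real (p / 2 - r)) (bv (Hb (p + r)))"
| "br (Gb r) (Gb t) = bv (Ib (r + t))"
| "br (Ib p) (Gb r) = smul (of_real (p - 2 * r)) (bv (Hb (p + r)))"
| "br (Gb r) (Ib p) = smul (- of_real (p - 2 * r)) (bv (Hb (p + r)))"
| "br _ _ = (\<lambda>_. 0)"

definition brk :: "(lbl \<Rightarrow> complex) \<Rightarrow> (lbl \<Rightarrow> complex) \<Rightarrow> lbl \<Rightarrow> complex" where
  "brk u v = (\<lambda>z. \<Sum>a\<in>spt u. \<Sum>b\<in>spt v. u a * v b * br a b z)"

definition tens :: "(lbl \<Rightarrow> complex) \<Rightarrow> (lbl \<Rightarrow> complex) \<Rightarrow> lbl \<times> lbl \<Rightarrow> complex" where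
  "tens u v = (\<lambda>(a, b). u a * v b)"

fun valid :: "real set \<Rightarrow> real \<Rightarrow> lbl \<Rightarrow> bool" where
  "valid \<Gamma> s (Lb p) = (p \<in> \<Gamma>)"
| "valid \<Gamma> s (Ib p) = (p \<in> \<Gamma>)"
| "valid \<Gamma> s (Gb r) = (r - s \<in> \<Gamma>)"
| "valid \<Gamma> s (Hb r) = (r - s \<in> \<Gamma>)"

definition inL :: "real set \<Rightarrow> real \<Rightarrow> (lbl \<Rightarrow> complex) \<Rightarrow> bool" where
  "inL \<Gamma> s u \<longleftrightarrow> finite (spt u) \<and> (\<forall>a\<in>spt u. valid \<Gamma> s a)"

definition inL2 :: "real set \<Rightarrow> real \<Rightarrow> (lbl \<times> lbl \<Rightarrow> complex) \<Rightarrow> bool" where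
  "inL2 \<Gamma> s t \<longleftrightarrow> finite (spt t) \<and> (\<forall>(a, b)\<in>spt t. valid \<Gamma> s a \<and> valid \<Gamma> s b)"

definition homog :: "nat \<Rightarrow> (lbl \<Rightarrow> complex) \<Rightarrow> bool" where
  "homog d u \<longleftrightarrow> (\<forall>a\<in>spt u. par a = d)"

definition homog2 :: "nat \<Rightarrow> (lbl \<times> lbl \<Rightarrow> complex) \<Rightarrow> bool" where
  "homog2 d t \<longleftrightarrow> (\<forall>(a, b)\<in>spt t. (par a + par b) mod 2 = d)"

definition tau :: "(lbl \<times> lbl \<Rightarrow> complex) \<Rightarrow> lbl \<times> lbl \<Rightarrow> complex" where
  "tau t = (\<lambda>(a, b). ssign a b * t (b, a))"

text \<open>Super-cyclic map: xi(e1 (x) e2 (x) e3) = (-1)^{[e1]([e2]+[e3])} e2 (x) e3 (x) e1.\<close>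
definition xi :: "(lbl \<times> lbl \<times> lbl \<Rightarrow> complex) \<Rightarrow> lbl \<times> lbl \<times> lbl \<Rightarrow> complex" where
  "xi t = (\<lambda>(x1, x2, x3). (-1) ^ (par x3 * (par x1 + par x2)) * t (x3, x1, x2))"

definition idD :: "((lbl \<Rightarrow> complex) \<Rightarrow> lbl \<times> lbl \<Rightarrow> complex)
    \<Rightarrow> (lbl \<times> lbl \<Rightarrow> complex) \<Rightarrow> lbl \<times> lbl \<times> lbl \<Rightarrow> complex" where
  "idD D t = (\<lambda>(a, b, c). \<Sum>q\<in>spt t. if fst q = a then t q * D (bv (snd q)) (b, c) else 0)"

definition actb :: "lbl \<Rightarrow> lbl \<Rightarrow> lbl \<Rightarrow> lbl \<times> lbl \<Rightarrow> complex" where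
  "actb c a b = (\<lambda>p. tens (br c a) (bv b) p + ssign c a * tens (bv a) (br c b) p)"

definition act :: "(lbl \<Rightarrow> complex) \<Rightarrow> (lbl \<times> lbl \<Rightarrow> complex) \<Rightarrow> lbl \<times> lbl \<Rightarrow> complex" where
  "act x t = (\<lambda>p. \<Sum>c\<in>spt x. \<Sum>q\<in>spt t. x c * t q * actb c (fst q) (snd q) p)"

definition in_im_1_minus_tau :: "real set \<Rightarrow> real \<Rightarrow> (lbl \<times> lbl \<Rightarrow> complex) \<Rightarrow> bool" where
  "in_im_1_minus_tau \<Gamma> s t \<longleftrightarrow> (\<exists>y. inL2 \<Gamma> s y \<and> t = (\<lambda>p. y p - tau y p))"

definition cYB :: "(lbl \<times> lbl \<Rightarrow> complex) \<Rightarrow> lbl \<times> lbl \<times> lbl \<Rightarrow> complex" where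
  "cYB r = (\<lambda>(x, y, z). \<Sum>q\<in>spt r. \<Sum>q'\<in>spt r.
      (case q of (a, b) \<Rightarrow> case q' of (a', b') \<Rightarrow>
        r q * r q' *
          (ssign a' b * br a a' x * bv b y * bv b' z
           + bv a x * br b a' y * bv b' z
           + ssign a' b * bv a x * bv a' y * br b b' z)))"

definition add_subgroup :: "real set \<Rightarrow> bool" where
  "add_subgroup \<Gamma> \<longleftrightarrow> 0 \<in> \<Gamma> \<and> (\<forall>x\<in>\<Gamma>. \<forall>y\<in>\<Gamma>. x + y \<in> \<Gamma>) \<and> (\<forall>x\<in>\<Gamma>. - x \<in> \<Gamma>)"

definition lie_super_bialgebra :: "real set \<Rightarrow> real \<Rightarrow> ((lbl \<Rightarrow> complex) \<Rightarrow> lbl \<times> lbl \<Rightarrow> complex) \<Rightarrow> bool" where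
  "lie_super_bialgebra \<Gamma> s D \<longleftrightarrow>
     \<comment> \<open>linear map L -> L (x) L\<close>
     (\<forall>u. inL \<Gamma> s u \<longrightarrow> inL2 \<Gamma> s (D u))
   \<and> (\<forall>u v. inL \<Gamma> s u \<longrightarrow> inL \<Gamma> s v \<longrightarrow> D (\<lambda>a. u a + v a) = (\<lambda>p. D u p + D v p))
   \<and> (\<forall>c u. inL \<Gamma> s u \<longrightarrow> D (smul c u) = smul c (D u))
     \<comment> \<open>parity preserving\<close>
   \<and> (\<forall>u d. inL \<Gamma> s u \<longrightarrow> d < 2 \<longrightarrow> homog d u \<longrightarrow> homog2 d (D u))
     \<comment> \<open>Im Delta in Im(1 (x) 1 - tau)\<close>
   \<and> (\<forall>u. inL \<Gamma> s u \<longrightarrow> in_im_1_minus_tau \<Gamma> s (D u))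
     \<comment> \<open>co-Jacobi identity\<close>
   \<and> (\<forall>u. inL \<Gamma> s u \<longrightarrow>
        (let w = idD D (D u) in (\<lambda>p. w p + xi w p + xi (xi w) p)) = (\<lambda>_. 0))
     \<comment> \<open>compatibility (cocycle) condition\<close>
   \<and> (\<forall>x y dx dy. inL \<Gamma> s x \<longrightarrow> inL \<Gamma> s y \<longrightarrow> dx < 2 \<longrightarrow> dy < 2 \<longrightarrow>
        homog dx x \<longrightarrow> homog dy y \<longrightarrow>
        D (brk x y) = (\<lambda>p. act x (D y) p - (-1) ^ (dx * dy) * act y (D x) p))"

end

theory Submission
  imports Defs
begin

text \<open>
  With respect to the Witt subalgebra spanned by the \<open>L\<^sub>p\<close>, every family of basis vectors is a density
  module: \<open>[L\<^sub>p, a] = (c p - w) a'\<close>, where \<open>w\<close> is the index of \<open>a\<close>, where \<open>c\<close> is \<open>1\<close> or \<open>1/2\<close>, and where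
  \<open>a'\<close> is \<open>a\<close> with index shifted by \<open>p\<close>.  As \<open>\<Gamma>\<close> lies in the reals, a finitely supported tensor has a
  leading term with respect to the index of its first factor, on which \<open>L\<^sub>p\<close> with \<open>p > 0\<close> acts through that factor only.
  Looking at leading terms shows that \<open>L \<otimes> L\<close> and \<open>L \<otimes> L \<otimes> L\<close> have no invariants and that
  there is no Witt homomorphism from \<open>L\<close> to \<open>L \<otimes> L\<close>.

  Given the cocycle \<open>\<Delta>\<close>, subtract a coboundary to get \<open>\<Delta>(L\<^sub>0) = 0\<close>; then \<open>\<Delta>\<close> preserves the weight.
  The values of a weight-zero coboundary at \<open>L\<^sub>p\<close> and \<open>L\<^sub>2\<^sub>p\<close> determine the tensor by an elimination
  formula; applying this formula to \<open>\<Delta>\<close> and subtracting the coboundary of the outcome leaves a cocycle whose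
  leading terms at \<open>L\<^sub>p\<close> and \<open>L\<^sub>2\<^sub>p\<close> satisfy two independent linear relations, so they vanish.
  Hence \<open>\<Delta>\<close> vanishes at all \<open>L\<^sub>k\<^sub>p\<close> with \<open>k \<ge> 1\<close> and is a homomorphism for these elements, so it is zero
  on negative indices, then on positive ones, and finally on index zero.

  So \<open>\<Delta>(x) = x \<circ> r\<close> with \<open>r\<close> even.  Both \<open>r + \<tau> r\<close> and \<open>c(r)\<close> are invariant under all \<open>L\<^sub>p\<close>, the latter
  because the co-Jacobi expression at \<open>L\<^sub>p\<close> equals \<open>L\<^sub>p \<circ> c(r)\<close>; so both vanish.
\<close>

section \<open>Weights and shifts of labels\<close>

fun wt :: "lbl \<Rightarrow> real" where
  "wt (Lb p) = p" | "wt (Ib p) = p" | "wt (Gb p) = p" | "wt (Hb p) = p"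

fun cc :: "lbl \<Rightarrow> real" where
  "cc (Lb _) = 1" | "cc (Ib _) = 1" | "cc (Gb _) = 1 / 2" | "cc (Hb _) = 1 / 2"

fun sh :: "real \<Rightarrow> lbl \<Rightarrow> lbl" where
  "sh q (Lb p) = Lb (p + q)" | "sh q (Ib p) = Ib (p + q)"
| "sh q (Gb p) = Gb (p + q)" | "sh q (Hb p) = Hb (p + q)"

definition al :: "real \<Rightarrow> lbl \<Rightarrow> complex" where
  "al p a = of_real (cc a * p - wt a)"

lemma wt_sh [simp]: "wt (sh p a) = wt a + p"
  by (cases a) auto

lemma cc_sh [simp]: "cc (sh p a) = cc a"
  by (cases a) auto

lemma par_sh [simp]: "par (sh p a) = par a"
  by (cases a) auto

lemma sh_sh [simp]: "sh p (sh q a) = sh (p + q) a"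
  by (cases a) auto

lemma sh_0 [simp]: "sh 0 a = a"
  by (cases a) auto

lemma sh_eq_iff: "sh p a = b \<longleftrightarrow> a = sh (- p) b"
  by auto

lemma inj_sh: "inj (sh p)"
  by (rule injI) (simp add: sh_eq_iff)

lemma cc_cases: "cc a = 1 \<or> cc a = 1 / 2"
  by (cases a) auto

lemma cc_pos: "cc a > 0"
  by (cases a) auto

lemma par_cases: "par a = 0 \<or> par a = 1"
  by (cases a) auto

text \<open>Even tensors therefore pair labels of equal density only, which the elimination formula
  below requires.\<close>

lemma cc_eq_iff: "cc a = cc b \<longleftrightarrow> par a = par b"
  by (cases a; cases b) auto

lemma ssign_sh [simp]: "ssign (sh p a) b = ssign a b" "ssign a (sh p b) = ssign a b"
  by (simp_all add: ssign_def)

lemma br_Lb: "br (Lb p) a = smul (al p a) (bv (sh p a))"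
  by (cases a) (auto simp: al_def add.commute)

text \<open>The super-Jacobi identity for \<open>L_p\<close>, \<open>a\<close>, \<open>b\<close>,
  read off at the coefficient of \<open>x\<close>: only \<open>sh (- p) x\<close> can be carried to
  \<open>x\<close> by \<open>L_p\<close>. There are no signs because \<open>L_p\<close> is
  even.\<close>

lemma br_jacobi_Lb:
  "al p (sh (- p) x) * br a b (sh (- p) x) = al p a * br (sh p a) b x + al p b * br a (sh p b) x"
  by (cases a; cases b; cases x) (auto simp: al_def smul_def bv_def field_simps)

lemma br_parity: "br a b x \<noteq> 0 \<Longrightarrow> par x = (par a + par b) mod 2"
  by (cases a; cases b; cases x) (auto simp: smul_def bv_def split: if_splits)

lemma br_swap: "br a b x = - ssign a b * br b a x"
  by (cases a; cases b; cases x) (auto simp: smul_def bv_def ssign_def algebra_simps)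

lemma spt_bv [simp]: "spt (bv a) = {a}"
  by (auto simp: spt_def bv_def)

lemma bv_self [simp]: "bv a a = 1"
  by (simp add: bv_def)

lemma finite_spt_br: "finite (spt (br a b))"
proof -
  have "finite (spt (smul k (bv z)))" for k z
    by (rule finite_subset[of _ "{z}"]) (auto simp: spt_def smul_def bv_def)
  moreover have "finite (spt (\<lambda>_::lbl. 0))"
    by (simp add: spt_def)
  ultimately show ?thesis
    by (cases a; cases b) auto
qed

section \<open>Finitely supported functions\<close>

text \<open>Only meaningful if \<open>f\<close> has finite support; otherwise the sum is \<open>0\<close>.\<close>

definition pr :: "(lbl \<Rightarrow> complex) \<Rightarrow> (lbl \<Rightarrow> complex) \<Rightarrow> complex" where
  "pr f h = (\<Sum>a\<in>spt f. f a * h a)"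

lemma pr_superset:
  assumes "finite S" "spt f \<subseteq> S"
  shows "pr f h = (\<Sum>a\<in>S. f a * h a)"
  unfolding pr_def by (rule sum.mono_neutral_left) (use assms in \<open>auto simp: spt_def\<close>)

lemma pr_add_left:
  assumes "finite (spt f)" "finite (spt g)"
  shows "pr (\<lambda>a. f a + g a) h = pr f h + pr g h"
proof -
  have "spt (\<lambda>a. f a + g a) \<subseteq> spt f \<union> spt g"
    by (auto simp: spt_def)
  then show ?thesis
    using assms by (simp add: pr_superset[where S = "spt f \<union> spt g"] sum.distrib algebra_simps)
qed

lemma pr_smul_left:
  shows "pr (\<lambda>a. k * f a) h = k * pr f h"
proof (cases "k = 0")
  case False
  then have "spt (\<lambda>a. k * f a) = spt f"
    by (auto simp: spt_def)
  then show ?thesis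
    by (simp add: pr_def sum_distrib_left algebra_simps)
qed (simp add: pr_def)

lemma pr_add_right: "pr f (\<lambda>a. h a + h' a) = pr f h + pr f h'"
  by (simp add: pr_def sum.distrib algebra_simps)

lemma pr_smul_right: "pr f (\<lambda>a. k * h a) = k * pr f h"
  by (simp add: pr_def sum_distrib_left algebra_simps)

lemma pr_shift: "pr (\<lambda>a. f (sh (- p) a)) h = pr f (\<lambda>a. h (sh p a))"
proof -
  have eq: "spt (\<lambda>a. f (sh (- p) a)) = sh p ` spt f"
    by (force simp: spt_def image_iff)
  have "inj_on (sh p) (spt f)"
    using inj_sh by (rule inj_on_subset) simp
  then show ?thesis
    by (simp add: pr_def eq sum.reindex)
qed

lemma pr_mult:
  assumes "finite (spt f)"
  shows "pr (\<lambda>a. k a * f a) h = pr f (\<lambda>a. k a * h a)"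
proof -
  have "spt (\<lambda>a. k a * f a) \<subseteq> spt f"
    by (auto simp: spt_def)
  then show ?thesis
    using assms by (simp add: pr_superset[where S = "spt f"] algebra_simps)
qed

lemma finite_spt_col: "finite (spt t) \<Longrightarrow> finite (spt (\<lambda>a. t (a, y)))"
  by (rule finite_subset[of _ "fst ` spt t"]) (force simp: spt_def)+

lemma finite_spt_row: "finite (spt t) \<Longrightarrow> finite (spt (\<lambda>b. t (x, b)))"
  by (rule finite_subset[of _ "snd ` spt t"]) (force simp: spt_def)+

lemma finite_spt_reindex:
  assumes "finite (spt f)" "inj g"
  shows "finite (spt (\<lambda>a. f (g a)))"
proof -
  have "spt (\<lambda>a. f (g a)) = g -` spt f"
    by (auto simp: spt_def)
  then show ?thesis
    using assms by (simp add: finite_vimageI)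
qed

lemma finite_spt_mult: "finite (spt f) \<Longrightarrow> finite (spt (\<lambda>a. k a * f a))"
  by (rule finite_subset[of _ "spt f"]) (auto simp: spt_def)

lemma finite_spt_add: "finite (spt f) \<Longrightarrow> finite (spt g) \<Longrightarrow> finite (spt (\<lambda>a. f a + g a))"
  by (rule finite_subset[of _ "spt f \<union> spt g"]) (auto simp: spt_def)

lemma finite_spt_diff: "finite (spt f) \<Longrightarrow> finite (spt g) \<Longrightarrow> finite (spt (\<lambda>a. f a - g a))"
  by (rule finite_subset[of _ "spt f \<union> spt g"]) (auto simp: spt_def)

lemma finite_spt_sum:
  assumes "finite S" "\<And>i. i \<in> S \<Longrightarrow> finite (spt (f i))"
  shows "finite (spt (\<lambda>q. \<Sum>i\<in>S. f i q))"
  by (rule finite_subset[of _ "\<Union>i\<in>S. spt (f i)"])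
    (use assms in \<open>auto simp: spt_def dest: sum.not_neutral_contains_not_neutral\<close>)

text \<open>The delta factor cuts the sum down to one column; in this way the sums in
  \<open>act\<close> and \<open>cYB\<close> become pairings.\<close>

lemma sum_col:
  assumes "finite (spt t)"
  shows "(\<Sum>q\<in>spt t. t q * (bv (snd q) z * h q)) = pr (\<lambda>u. t (u, z)) (\<lambda>u. h (u, z))"
proof -
  have "(\<Sum>q\<in>spt t. t q * (bv (snd q) z * h q)) = (\<Sum>q\<in>(\<lambda>u. (u, z)) ` spt (\<lambda>u. t (u, z)). t q * h q)"
    by (rule sum.mono_neutral_cong_right) (use assms in \<open>auto simp: spt_def bv_def image_iff\<close>)
  also have "\<dots> = pr (\<lambda>u. t (u, z)) (\<lambda>u. h (u, z))"
    by (simp add: pr_def sum.reindex inj_on_def)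
  finally show ?thesis .
qed

lemma sum_row:
  assumes "finite (spt t)"
  shows "(\<Sum>q\<in>spt t. t q * (bv (fst q) y * h q)) = pr (\<lambda>w. t (y, w)) (\<lambda>w. h (y, w))"
proof -
  have "(\<Sum>q\<in>spt t. t q * (bv (fst q) y * h q)) = (\<Sum>q\<in>(\<lambda>w. (y, w)) ` spt (\<lambda>w. t (y, w)). t q * h q)"
    by (rule sum.mono_neutral_cong_right) (use assms in \<open>auto simp: spt_def bv_def image_iff\<close>)
  also have "\<dots> = pr (\<lambda>w. t (y, w)) (\<lambda>w. h (y, w))"
    by (simp add: pr_def sum.reindex inj_on_def)
  finally show ?thesis .
qed

section \<open>The action on tensors\<close>

text \<open>The coefficients of \<open>L\<^sub>p \<circ> t\<close> in closed form, which makes sense without any condition on the support.\<close>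

definition lact :: "real \<Rightarrow> (lbl \<times> lbl \<Rightarrow> complex) \<Rightarrow> lbl \<times> lbl \<Rightarrow> complex" where
  "lact p t = (\<lambda>(a, b). al p (sh (- p) a) * t (sh (- p) a, b) + al p (sh (- p) b) * t (a, sh (- p) b))"

lemma act_bv:
  assumes "finite (spt t)"
  shows "act (bv a) t (y, z) =
    pr (\<lambda>u. t (u, z)) (\<lambda>u. br a u y) + ssign a y * pr (\<lambda>w. t (y, w)) (\<lambda>w. br a w z)"
proof -
  have "act (bv a) t (y, z) = (\<Sum>q\<in>spt t. t q * (bv (snd q) z * br a (fst q) y)
      + t q * (bv (fst q) y * (ssign a (fst q) * br a (snd q) z)))"
    by (simp add: act_def actb_def tens_def algebra_simps)
  then show ?thesis
    by (simp add: sum.distrib sum_col[OF assms] sum_row[OF assms] pr_smul_right)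
qed

lemma finite_spt_act_bv:
  assumes "finite (spt t)"
  shows "finite (spt (act (bv a) t))"
proof -
  have tens: "finite (spt (tens f g))" if "finite (spt f)" "finite (spt g)" for f g
    by (rule finite_subset[of _ "spt f \<times> spt g"]) (use that in \<open>auto simp: spt_def tens_def\<close>)
  have "finite (spt (actb a u v))" for u v
    unfolding actb_def
    by (intro finite_spt_add finite_spt_mult tens finite_spt_br) simp_all
  then show ?thesis
    unfolding act_def using assms by (auto intro!: finite_spt_sum finite_spt_mult)
qed

lemma act_bv_Lb:
  assumes "finite (spt t)"
  shows "act (bv (Lb p)) t = lact p t"
proof -
  \<comment> \<open>The only label that \<open>L_p\<close> can carry to \<open>y\<close> is
    \<open>sh (- p) y\<close>; it is inserted into the summation set because it may lie outside the
    support.\<close>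
  have pick: "pr f (\<lambda>u. br (Lb p) u y) = al p (sh (- p) y) * f (sh (- p) y)" if "finite (spt f)" for f y
  proof -
    have "pr f (\<lambda>u. br (Lb p) u y) = (\<Sum>u\<in>insert (sh (- p) y) (spt f). f u * br (Lb p) u y)"
      by (rule pr_superset) (use that in auto)
    also have "\<dots> = (\<Sum>u\<in>insert (sh (- p) y) (spt f). if u = sh (- p) y then al p u * f u else 0)"
      by (rule sum.cong) (auto simp: br_Lb smul_def bv_def)
    also have "\<dots> = al p (sh (- p) y) * f (sh (- p) y)"
      using that by simp
    finally show ?thesis .
  qed
  have "ssign (Lb p) y = 1" for y
    by (simp add: ssign_def)
  then show ?thesis
    using assms
    by (auto simp: lact_def act_bv pick finite_spt_col finite_spt_row)
qed

lemma finite_spt_lact: "finite (spt t) \<Longrightarrow> finite (spt (lact p t))"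
  using finite_spt_act_bv[of t "Lb p"] act_bv_Lb[of t p] by simp

text \<open>Summation by parts: on the contracted factor \<open>L_p\<close> moves over to
  \<open>h\<close>, while its action on the free factor stays outside.\<close>

lemma pr_col_lact:
  assumes "finite (spt t)"
  shows "pr (\<lambda>a. lact p t (a, y)) h =
    pr (\<lambda>a. t (a, y)) (\<lambda>a. al p a * h (sh p a)) + al p (sh (- p) y) * pr (\<lambda>a. t (a, sh (- p) y)) h"
proof -
  have "pr (\<lambda>a. lact p t (a, y)) h =
      pr (\<lambda>a. al p (sh (- p) a) * t (sh (- p) a, y)) h + pr (\<lambda>a. al p (sh (- p) y) * t (a, sh (- p) y)) h"
    unfolding lact_def prod.case
    by (rule pr_add_left)
      (intro finite_spt_mult finite_spt_col finite_spt_reindex[where f = "\<lambda>a. t (a, y)"] assms inj_sh)+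
  then show ?thesis
    using assms
    by (simp add: pr_shift[where f = "\<lambda>a. al p a * t (a, y)"] pr_smul_left pr_mult finite_spt_col)
qed

lemma pr_row_lact:
  assumes "finite (spt t)"
  shows "pr (\<lambda>b. lact p t (x, b)) h =
    al p (sh (- p) x) * pr (\<lambda>b. t (sh (- p) x, b)) h + pr (\<lambda>b. t (x, b)) (\<lambda>b. al p b * h (sh p b))"
proof -
  have "pr (\<lambda>b. lact p t (x, b)) h =
      pr (\<lambda>b. al p (sh (- p) x) * t (sh (- p) x, b)) h + pr (\<lambda>b. al p (sh (- p) b) * t (x, sh (- p) b)) h"
    unfolding lact_def prod.case
    by (rule pr_add_left)
      (intro finite_spt_mult finite_spt_row finite_spt_reindex[where f = "\<lambda>b. t (x, b)"] assms inj_sh)+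
  then show ?thesis
    using assms
    by (simp add: pr_shift[where f = "\<lambda>b. al p b * t (x, b)"] pr_smul_left pr_mult finite_spt_row)
qed

text \<open>Applied to each factor, the Jacobi identity gives this module law of the diagonal
  action; it makes every coboundary a cocycle.\<close>

lemma lact_act:
  assumes "finite (spt t)"
  shows "lact p (act (bv a) t) q = act (bv a) (lact p t) q + al p a * act (bv (sh p a)) t q"
proof (cases q)
  case (Pair y z)
  have jac: "al p (sh (- p) y) * pr f (\<lambda>u. br a u (sh (- p) y)) =
      pr f (\<lambda>u. al p u * br a (sh p u) y) + al p a * pr f (\<lambda>u. br (sh p a) u y)" for f y
    by (simp add: pr_smul_right[symmetric] pr_add_right[symmetric] br_jacobi_Lb add.commute)
  have "lact p (act (bv a) t) (y, z) =
      al p (sh (- p) y) * pr (\<lambda>u. t (u, z)) (\<lambda>u. br a u (sh (- p) y))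
    + al p (sh (- p) y) * ssign a y * pr (\<lambda>w. t (sh (- p) y, w)) (\<lambda>w. br a w z)
    + al p (sh (- p) z) * pr (\<lambda>u. t (u, sh (- p) z)) (\<lambda>u. br a u y)
    + ssign a y * (al p (sh (- p) z) * pr (\<lambda>w. t (y, w)) (\<lambda>w. br a w (sh (- p) z)))"
    by (simp add: lact_def act_bv[OF assms] algebra_simps)
  then show ?thesis
    by (simp add: Pair act_bv[OF finite_spt_lact[OF assms]] act_bv[OF assms] jac
        pr_col_lact[OF assms] pr_row_lact[OF assms] algebra_simps)
qed

lemma act_bv_diff:
  assumes "finite (spt t)" "finite (spt t')"
  shows "act (bv a) (\<lambda>q. t q - t' q) q = act (bv a) t q - act (bv a) t' q"
proof (cases q)
  case (Pair y z)
  have pr_diff: "pr (\<lambda>a. f a - g a) h = pr f h - pr g h" if "finite (spt f)" "finite (spt g)" for f g h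
    using pr_add_left[OF that(1) finite_spt_mult[OF that(2)], of "\<lambda>_. - 1" h] pr_smul_left[of "- 1" g h]
    by simp
  show ?thesis
    using assms
    by (simp add: Pair act_bv finite_spt_diff pr_diff finite_spt_col finite_spt_row algebra_simps)
qed

section \<open>Leading coefficients\<close>

lemma finite_maximizer:
  fixes f :: "'a \<Rightarrow> real"
  assumes "finite S" "S \<noteq> {}"
  obtains x where "x \<in> S" "\<And>y. y \<in> S \<Longrightarrow> f y \<le> f x"
proof -
  have "Max (f ` S) \<in> f ` S"
    using assms by (intro Max_in) auto
  then obtain x where x: "x \<in> S" "f x = Max (f ` S)"
    by auto
  show thesis
    by (rule that[of x]) (use x assms(1) in auto)
qed

lemma mult_scaled_pos:
  fixes p k :: real
  assumes "p \<noteq> 0" "k > 0"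
  shows "p * (k * p) > 0"
proof -
  have "p * p > 0"
    using assms(1) not_real_square_gt_zero by blast
  then have "k * (p * p) > 0"
    using assms(2) by (rule mult_pos_pos[rotated])
  then show ?thesis
    by (simp only: mult_ac)
qed

text \<open>As a function of \<open>p\<close>, \<open>al p a\<close> is affine with nonzero slope
  \<open>cc a\<close>, so it has only one zero.\<close>

lemma al_al2_zero:
  assumes "al p a = 0" "al (2 * p) a = 0"
  shows "p = 0"
proof -
  have "cc a * p = wt a" "cc a * (2 * p) = wt a"
    using assms unfolding al_def of_real_eq_0_iff by linarith+
  then have "cc a * p = 0"
    by simp
  then show ?thesis
    using cc_pos[of a] by simp
qed

text \<open>On a term whose first label \<open>u\<close> maximizes \<open>p * wt u\<close>, both
  \<open>L_p\<close> and \<open>L_2p\<close> act outward through the first factor alone, so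
  \<open>al p u\<close> and \<open>al (2 * p) u\<close> would both vanish. Multiplying the weight by
  \<open>p\<close> covers either sign of \<open>p\<close>.\<close>

lemma lact_invariant_zero:
  assumes fin: "finite (spt t)" and "p \<noteq> 0" and inv: "lact p t = (\<lambda>_. 0)" "lact (2 * p) t = (\<lambda>_. 0)"
  shows "t = (\<lambda>_. 0)"
proof (rule ccontr)
  assume "t \<noteq> (\<lambda>_. 0)"
  then have "spt t \<noteq> {}"
    by (auto simp: spt_def)
  then obtain m where m: "m \<in> spt t" and max: "\<And>q. q \<in> spt t \<Longrightarrow> p * wt (fst q) \<le> p * wt (fst m)"
    using finite_maximizer[OF fin, of "\<lambda>q. p * wt (fst q)"] by metis
  obtain u v where uv: "m = (u, v)"
    by fastforce
  have "al (k * p) u = 0" if "k > 0" "lact (k * p) t = (\<lambda>_. 0)" for k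
  proof -
    have "p * (k * p) > 0"
      using \<open>p \<noteq> 0\<close> \<open>k > 0\<close> by (simp add: mult_scaled_pos)
    then have "t (sh (k * p) u, w) = 0" for w
      using max[of "(sh (k * p) u, w)"] uv by (auto simp: spt_def algebra_simps)
    then have "lact (k * p) t (sh (k * p) u, v) = al (k * p) u * t (u, v)"
      by (simp add: lact_def)
    then show ?thesis
      using that m uv by (simp add: spt_def)
  qed
  from this[of 1] this[of 2] show False
    using inv al_al2_zero[of p u] \<open>p \<noteq> 0\<close> by simp
qed

definition lact3 :: "real \<Rightarrow> (lbl \<times> lbl \<times> lbl \<Rightarrow> complex) \<Rightarrow> lbl \<times> lbl \<times> lbl \<Rightarrow> complex" where
  "lact3 p t = (\<lambda>(a, b, c). al p (sh (- p) a) * t (sh (- p) a, b, c)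
     + al p (sh (- p) b) * t (a, sh (- p) b, c) + al p (sh (- p) c) * t (a, b, sh (- p) c))"

text \<open>Only the first factor is ordered, so the argument for two factors carries over.\<close>

lemma lact3_invariant_zero:
  assumes fin: "finite (spt t)" and "p \<noteq> 0" and inv: "lact3 p t = (\<lambda>_. 0)" "lact3 (2 * p) t = (\<lambda>_. 0)"
  shows "t = (\<lambda>_. 0)"
proof (rule ccontr)
  assume "t \<noteq> (\<lambda>_. 0)"
  then have "spt t \<noteq> {}"
    by (auto simp: spt_def)
  then obtain m where m: "m \<in> spt t" and max: "\<And>q. q \<in> spt t \<Longrightarrow> p * wt (fst q) \<le> p * wt (fst m)"
    using finite_maximizer[OF fin, of "\<lambda>q. p * wt (fst q)"] by metis
  obtain u v w where uvw: "m = (u, v, w)"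
    by (metis prod.exhaust)
  have "al (k * p) u = 0" if "k > 0" "lact3 (k * p) t = (\<lambda>_. 0)" for k
  proof -
    have "p * (k * p) > 0"
      using \<open>p \<noteq> 0\<close> \<open>k > 0\<close> by (simp add: mult_scaled_pos)
    then have "t (sh (k * p) u, v', w') = 0" for v' w'
      using max[of "(sh (k * p) u, v', w')"] uvw by (auto simp: spt_def algebra_simps)
    then have "lact3 (k * p) t (sh (k * p) u, v, w) = al (k * p) u * t (u, v, w)"
      by (simp add: lact3_def)
    then show ?thesis
      using that m uvw by (simp add: spt_def)
  qed
  from this[of 1] this[of 2] show False
    using inv al_al2_zero[of p u] \<open>p \<noteq> 0\<close> by simp
qed

text \<open>The two sides of the hypothesis are quadratic in \<open>j\<close>; their second differences give the conclusion.\<close>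

lemma density_hom_rigid:
  fixes c g x n p k :: real
  assumes "c * g * p \<noteq> 0"
    and "\<And>j. j \<in> {1, 2, 3} \<Longrightarrow>
      (g * (j * p) - n - k * p) * (c * ((j + k) * p) - x) * (g * (k * p) - n)
      = (c * (j * p) - x - k * p) * (c * (k * p) - x) * (g * ((j + k) * p) - n)"
  shows "g * (k * p) - n = c * (k * p) - x"
proof -
  define d where "d j = (g * (j * p) - n - k * p) * (c * ((j + k) * p) - x) * (g * (k * p) - n)
    - (c * (j * p) - x - k * p) * (c * (k * p) - x) * (g * ((j + k) * p) - n)" for j
  have "2 * (c * g * p) * p * (g * (k * p) - n - (c * (k * p) - x)) = d 1 - 2 * d 2 + d 3"
    by (simp add: d_def algebra_simps)
  also have "\<dots> = 0"
    using assms(2)[of 1] assms(2)[of 2] assms(2)[of 3] unfolding d_def by simp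
  finally show ?thesis
    using assms(1) by simp
qed

text \<open>The leading coefficients along the shifts of \<open>a\<close> behave like a homomorphism
  of density modules. Computing the one of index \<open>j + k\<close> directly and through index
  \<open>k\<close> gives the identity of \<open>density_hom_rigid\<close>, which forces the leading
  weight to be that of \<open>a\<close>.\<close>

lemma hom_leading_weight:
  fixes \<phi> :: "lbl \<Rightarrow> lbl \<times> lbl \<Rightarrow> complex"
  assumes fin: "finite (spt (\<phi> a))" and neg: "wt a * p < 0"
    and hom: "\<And>j k q. j > (0::nat) \<Longrightarrow>
      lact (real j * p) (\<phi> (sh (real k * p) a)) q = al (real j * p) (sh (real k * p) a) * \<phi> (sh ((real j + real k) * p) a) q"
    and uv: "\<phi> a (u, v) \<noteq> 0"
  shows "wt u * p \<le> wt a * p"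
proof -
  have "spt (\<phi> a) \<noteq> {}"
    using uv by (auto simp: spt_def)
  then obtain m where m: "m \<in> spt (\<phi> a)"
    and max: "\<And>q. q \<in> spt (\<phi> a) \<Longrightarrow> p * wt (fst q) \<le> p * wt (fst m)"
    using finite_maximizer[OF fin, of "\<lambda>q. p * wt (fst q)"] by metis
  obtain u' v' where m_eq: "m = (u', v')"
    by fastforce
  define t where "t = \<phi> a (u', v')"
  define e where "e k = \<phi> (sh (real k * p) a) (sh (real k * p) u', v')" for k :: nat
  define c g x n where "c = cc u'" "g = cc a" "x = wt u'" "n = wt a"
  have "t \<noteq> 0"
    using m m_eq by (simp add: t_def spt_def)
  have "p \<noteq> 0"
    using neg by auto
  have big0: "\<phi> a (sh (real k * p) u', w) = 0" if "k > 0" for k :: nat and w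
  proof -
    have "p * (real k * p) > 0"
      using \<open>p \<noteq> 0\<close> that by (simp add: mult_scaled_pos)
    then show ?thesis
      using max[of "(sh (real k * p) u', w)"] m_eq by (auto simp: spt_def algebra_simps)
  qed
  \<comment> \<open>Negativity of \<open>wt a * p\<close> ensures that \<open>L_kp\<close> does not
    annihilate \<open>a\<close>, so that \<open>\<phi> a\<close> determines the values at its
    shifts.\<close>
  have gpos: "g * (real k * p) - n \<noteq> 0" for k :: nat
  proof -
    have "(g * (real k * p) - n) * p = g * real k * (p * p) - n * p"
      by (simp add: algebra_simps)
    moreover have "g * real k * (p * p) \<ge> 0"
      using cc_pos[of a] by (simp add: c_g_x_n_def)
    ultimately have "(g * (real k * p) - n) * p > 0"
      using neg by (simp add: c_g_x_n_def)
    then show ?thesis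
      by auto
  qed
  have al_a: "al (real k * p) a = of_real (g * (real k * p) - n)"
    "al (real j * p) (sh (real k * p) a) = of_real (g * (real j * p) - n - real k * p)" for j k
    by (simp_all add: al_def c_g_x_n_def)
  have al_u: "al (real k * p) u' = of_real (c * (real k * p) - x)"
    "al (real j * p) (sh (real k * p) u') = of_real (c * (real j * p) - x - real k * p)" for j k
    by (simp_all add: al_def c_g_x_n_def)
  have hom0: "of_real (g * (real k * p) - n) * \<phi> (sh (real k * p) a) q = lact (real k * p) (\<phi> a) q"
    if "k > 0" for k :: nat and q
    using hom[of k 0 q] that by (simp add: al_a)
  have e1: "of_real (g * (real k * p) - n) * e k = of_real (c * (real k * p) - x) * t" if "k > 0" for k
    using hom0[OF that, of "(sh (real k * p) u', v')"] big0[OF that]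
    by (simp add: lact_def al_u e_def t_def)
  \<comment> \<open>The vanishing beyond the leading term passes from \<open>a\<close> to its
    shifts.\<close>
  have big: "\<phi> (sh (real k * p) a) (sh (real j * p + real k * p) u', w) = 0"
    if "j > 0" "k > 0" for j k :: nat and w
  proof -
    have "\<phi> a (sh (real j * p + real k * p) u', w) = 0" for w
      using big0[of "j + k" w] that by (simp add: algebra_simps)
    then have "of_real (g * (real k * p) - n) * \<phi> (sh (real k * p) a) (sh (real j * p + real k * p) u', w) = 0"
      using hom0[OF that(2), of "(sh (real j * p + real k * p) u', w)"] big0[OF that(1)]
      by (simp add: lact_def)
    then show ?thesis
      using gpos[of k] by (simp only: mult_eq_0_iff of_real_eq_0_iff) simp
  qed
  have e2: "of_real (g * (real j * p) - n - real k * p) * e (j + k) = of_real (c * (real j * p) - x - real k * p) * e k"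
    if "j > 0" "k > 0" for j k
    using hom[OF that(1), of k "(sh (real j * p + real k * p) u', v')"] big[OF that]
    by (simp add: lact_def al_a al_u e_def distrib_right)
  have rel: "(g * (real j * p) - n - real k * p) * (c * (real (j + k) * p) - x) * (g * (real k * p) - n)
      = (c * (real j * p) - x - real k * p) * (c * (real k * p) - x) * (g * (real (j + k) * p) - n)"
    if "j > 0" "k > 0" for j k
  proof -
    have "complex_of_real ((g * (real j * p) - n - real k * p) * (c * (real (j + k) * p) - x) * (g * (real k * p) - n)) * t
      = of_real (g * (real j * p) - n - real k * p) * (of_real (g * (real (j + k) * p) - n) * e (j + k)) * of_real (g * (real k * p) - n)"
      unfolding e1[OF add_pos_pos[OF that]] by simp
    also have "\<dots> = of_real (g * (real (j + k) * p) - n) * (of_real (g * (real k * p) - n)) * (of_real (g * (real j * p) - n - real k * p) * e (j + k))"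
      by (simp only: mult_ac)
    also have "\<dots> = of_real (g * (real (j + k) * p) - n) * of_real (c * (real j * p) - x - real k * p) * (of_real (g * (real k * p) - n) * e k)"
      unfolding e2[OF that] by (simp only: mult_ac)
    also have "\<dots> = complex_of_real ((c * (real j * p) - x - real k * p) * (c * (real k * p) - x) * (g * (real (j + k) * p) - n)) * t"
      unfolding e1[OF that(2)] by simp
    finally show ?thesis
      by (simp only: mult_right_cancel[OF \<open>t \<noteq> 0\<close>] of_real_eq_iff)
  qed
  have "c * g * p \<noteq> 0"
    using cc_pos[of u'] cc_pos[of a] \<open>p \<noteq> 0\<close> by (simp add: c_g_x_n_def)
  have "g * (real k * p) - n = c * (real k * p) - x" if "k > 0" for k
  proof (rule density_hom_rigid)
    fix i :: real
    assume "i \<in> {1, 2, 3}"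
    then have "i = real 1 \<or> i = real 2 \<or> i = real 3"
      by simp
    then obtain j where "j > 0" "i = real j"
      by (metis zero_less_numeral zero_less_one)
    then show "(g * (i * p) - n - real k * p) * (c * ((i + real k) * p) - x) * (g * (real k * p) - n)
        = (c * (i * p) - x - real k * p) * (c * (real k * p) - x) * (g * ((i + real k) * p) - n)"
      using rel[OF _ that, of j] by (simp only: of_nat_add)
  qed fact
  \<comment> \<open>Both sides are affine in \<open>k\<close>; the values at 1 and 2 give equality
    of the constant terms.\<close>
  from this[of 1] this[of 2] have "n = x"
    by simp
  then have "wt a = wt u'"
    by (simp add: c_g_x_n_def)
  then show ?thesis
    using max[of "(u, v)"] uv m_eq by (simp add: spt_def mult.commute)
qed

text \<open>The leading weight bound holds for both factors, so \<open>wt a * p\<close> would be at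
  most twice itself, which is impossible for a negative number.\<close>

lemma hom_zero:
  fixes \<phi> :: "lbl \<Rightarrow> lbl \<times> lbl \<Rightarrow> complex"
  assumes fin: "finite (spt (\<phi> a))" and neg: "wt a * p < 0"
    and hom: "\<And>j k q. j > (0::nat) \<Longrightarrow>
      lact (real j * p) (\<phi> (sh (real k * p) a)) q = al (real j * p) (sh (real k * p) a) * \<phi> (sh ((real j + real k) * p) a) q"
    and wts: "\<And>u v. \<phi> a (u, v) \<noteq> 0 \<Longrightarrow> wt u + wt v = wt a"
  shows "\<phi> a = (\<lambda>_. 0)"
proof (rule ccontr)
  assume "\<phi> a \<noteq> (\<lambda>_. 0)"
  then obtain u v where uv: "\<phi> a (u, v) \<noteq> 0"
    by fastforce
  have "wt u * p \<le> wt a * p"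
    using fin neg hom uv by (rule hom_leading_weight)
  \<comment> \<open>The unsigned flip of the factors commutes with \<open>lact\<close>, so the bound
    applies to the second factor too.\<close>
  moreover have "wt v * p \<le> wt a * p"
  proof (rule hom_leading_weight[of "\<lambda>b q. \<phi> b (snd q, fst q)"])
    show "finite (spt (\<lambda>q. \<phi> a (snd q, fst q)))"
      using fin by (rule finite_spt_reindex) (auto simp: inj_def)
    show "lact (real j * p) (\<lambda>q. \<phi> (sh (real k * p) a) (snd q, fst q)) q
        = al (real j * p) (sh (real k * p) a) * \<phi> (sh ((real j + real k) * p) a) (snd q, fst q)"
      if "j > 0" for j k q
      using hom[OF that, of k "(snd q, fst q)"] by (simp add: lact_def split_beta add.commute)
  qed (use neg uv in auto)
  moreover have "wt u * p + wt v * p = wt a * p"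
    using wts[OF uv] by (simp flip: distrib_right)
  ultimately show False
    using neg by linarith
qed

section \<open>Cocycles on the positive half of the Witt algebra\<close>

text \<open>The two ways to reach degree five, \<open>[L\<^sub>4, L\<^sub>1] = 3 [L\<^sub>3, L\<^sub>2]\<close>, give one linear relation between
  \<open>g\<^sub>1\<close> and \<open>g\<^sub>2\<close>, multiplied by a quadratic form in \<open>T\<close> and \<open>p\<close> that is definite for both densities.\<close>

lemma degree_five_relation:
  fixes c p T :: real and g1 g2 g3 g4 g5 :: complex
  assumes c: "c = 1 \<or> c = 1 / 2" and "p \<noteq> 0"
    and e3: "of_real p * g3 = of_real (2 * c * p - T - p) * g1 - of_real (c * p - T - 2 * p) * g2"
    and e4: "of_real (2 * p) * g4 = of_real (3 * c * p - T - p) * g1 - of_real (c * p - T - 3 * p) * g3"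
    and e5: "of_real (3 * p) * g5 = of_real (4 * c * p - T - p) * g1 - of_real (c * p - T - 4 * p) * g4"
    and e5': "of_real p * g5 = of_real (3 * c * p - T - 2 * p) * g2 - of_real (2 * c * p - T - 3 * p) * g3"
  shows "of_real (2 * c * p - T) * g1 = of_real (c * p - T) * g2"
  using c
proof
  assume "c = 1"
  define P t where "P = complex_of_real p" and "t = complex_of_real T"
  have "P * g3 = (P - t) * g1 - (- P - t) * g2" "2 * P * g4 = (2 * P - t) * g1 - (- 2 * P - t) * g3"
    "3 * P * g5 = (3 * P - t) * g1 - (- 3 * P - t) * g4" "P * g5 = (P - t) * g2 - (- P - t) * g3"
    using e3 e4 e5 e5' \<open>c = 1\<close> by (simp_all add: P_def t_def)
  then have "(t\<^sup>2 + t * P + 6 * P\<^sup>2) * ((2 * P - t) * g1 - (P - t) * g2) = 0"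
    by algebra
  moreover have "T\<^sup>2 + T * p + 6 * p\<^sup>2 \<noteq> 0"
  proof -
    have "T\<^sup>2 + T * p + 6 * p\<^sup>2 = (T + p / 2)\<^sup>2 + 23 / 4 * p\<^sup>2"
      by (simp add: power2_eq_square field_simps)
    then show ?thesis
      using \<open>p \<noteq> 0\<close> by (simp add: sum_power2_eq_zero_iff add_nonneg_eq_0_iff)
  qed
  moreover have "t\<^sup>2 + t * P + 6 * P\<^sup>2 = of_real (T\<^sup>2 + T * p + 6 * p\<^sup>2)"
    by (simp add: P_def t_def)
  ultimately have "(2 * P - t) * g1 - (P - t) * g2 = 0"
    by (metis mult_eq_0_iff of_real_eq_0_iff)
  then show ?thesis
    by (simp add: P_def t_def \<open>c = 1\<close>)
next
  assume "c = 1 / 2"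
  \<comment> \<open>Taking half of \<open>p\<close> as the variable makes all coefficients
    integral.\<close>
  define P t where "P = complex_of_real (p / 2)" and "t = complex_of_real T"
  have "2 * P * g3 = (- t) * g1 - (- 3 * P - t) * g2" "4 * P * g4 = (P - t) * g1 - (- 5 * P - t) * g3"
    "6 * P * g5 = (2 * P - t) * g1 - (- 7 * P - t) * g4" "2 * P * g5 = (- P - t) * g2 - (- 4 * P - t) * g3"
    using e3 e4 e5 e5' \<open>c = 1 / 2\<close> by (simp_all add: P_def t_def)
  then have "(t\<^sup>2 + 4 * t * P + 15 * P\<^sup>2) * ((2 * P - t) * g1 - (P - t) * g2) = 0"
    by algebra
  moreover have "T\<^sup>2 + 4 * T * (p / 2) + 15 * (p / 2)\<^sup>2 \<noteq> 0"
  proof -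
    have "T\<^sup>2 + 4 * T * (p / 2) + 15 * (p / 2)\<^sup>2 = (T + p)\<^sup>2 + 11 / 4 * p\<^sup>2"
      by (simp add: power2_eq_square field_simps)
    then show ?thesis
      using \<open>p \<noteq> 0\<close> by (simp add: add_nonneg_eq_0_iff)
  qed
  moreover have "t\<^sup>2 + 4 * t * P + 15 * P\<^sup>2 = of_real (T\<^sup>2 + 4 * T * (p / 2) + 15 * (p / 2)\<^sup>2)"
    by (simp add: P_def t_def)
  ultimately have "(2 * P - t) * g1 - (P - t) * g2 = 0"
    by (metis mult_eq_0_iff of_real_eq_0_iff)
  then show ?thesis
    by (simp add: P_def t_def \<open>c = 1 / 2\<close>)
qed

text \<open>If \<open>f\<^sub>1\<close>, \<open>f\<^sub>2\<close> are the images of a weight-zero tensor \<open>t\<close> under \<open>L\<^sub>p\<close> and \<open>L\<^sub>2\<^sub>p\<close>, the three values of \<open>f\<^sub>1\<close>, \<open>f\<^sub>2\<close>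
  below involve only three values of \<open>t\<close>, two of which cancel.  So \<open>t\<close> can be recovered from \<open>f\<^sub>1\<close>, \<open>f\<^sub>2\<close>.\<close>

definition elim :: "real \<Rightarrow> (lbl \<times> lbl \<Rightarrow> complex) \<Rightarrow> (lbl \<times> lbl \<Rightarrow> complex) \<Rightarrow> lbl \<Rightarrow> lbl \<Rightarrow> complex" where
  "elim p f1 f2 u v = al p (sh (- p) v) * al p (sh (- (2 * p)) v) * f2 (sh (2 * p) u, v)
    - al (2 * p) (sh (- (2 * p)) v)
      * (al p (sh (- p) v) * f1 (sh (2 * p) u, sh (- p) v) - al p (sh p u) * f1 (sh p u, v))"

text \<open>The factor by which the elimination formula multiplies \<open>t (u, v)\<close>; it
  depends on the density of \<open>u\<close> but not on its weight.\<close>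

definition elim_const :: "real \<Rightarrow> lbl \<Rightarrow> complex" where
  "elim_const p u = of_real (2 * cc u * (cc u + 1) * (2 * cc u + 1) * p ^ 3)"

lemma elim_const_nonzero: "p \<noteq> 0 \<Longrightarrow> elim_const p u \<noteq> 0"
  using cc_pos[of u] unfolding elim_const_def of_real_eq_0_iff by simp

text \<open>The left side occurs twice: as the coefficient of \<open>t (u, v)\<close> surviving the
  elimination, and as the determinant of the two relations between leading coefficients in
  \<open>positive_cocycle_zero\<close>.\<close>

lemma al_elim_const:
  assumes "wt u + wt v = 0" "cc u = cc v"
  shows "al (2 * p) (sh (- (2 * p)) v) * al p (sh p u) * al p u
    + al p (sh (- p) v) * al p (sh (- (2 * p)) v) * al (2 * p) u = elim_const p u"
proof -
  have v: "wt v = - wt u" "cc v = cc u"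
    using assms by auto
  show ?thesis
    unfolding al_def elim_const_def v wt_sh cc_sh of_real_mult[symmetric] of_real_add[symmetric] of_real_eq_iff
    by (simp add: power3_eq_cube algebra_simps)
qed

lemma elim_lact:
  assumes "wt u + wt v = 0" "cc u = cc v"
  shows "elim p (lact p t) (lact (2 * p) t) u v = elim_const p u * t (u, v)"
  unfolding al_elim_const[OF assms, symmetric] by (simp add: elim_def lact_def algebra_simps)

text \<open>\<open>F k\<close> stands for the value of a weight-preserving cocycle at
  \<open>L_kp\<close>. The cocycle identity up to degree five gives one relation between the leading
  coefficients in degrees 1 and 2, vanishing of \<open>elim\<close> gives another, and together they
  force both coefficients to be zero.\<close>

lemma positive_cocycle_zero:
  fixes F :: "nat \<Rightarrow> lbl \<times> lbl \<Rightarrow> complex"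
  assumes "p > 0"
    and fin: "finite (spt (F 1))" "finite (spt (F 2))"
    and cocycle: "\<And>i j q. i > 0 \<Longrightarrow> j > 0 \<Longrightarrow>
      lact (real i * p) (F j) q - lact (real j * p) (F i) q = of_real ((real i - real j) * p) * F (i + j) q"
    and wts: "\<And>k u v. k \<in> {1, 2} \<Longrightarrow> F k (u, v) \<noteq> 0 \<Longrightarrow> wt u + wt v = real k * p \<and> cc u = cc v"
    and elim: "\<And>u v. wt u + wt v = 0 \<Longrightarrow> cc u = cc v \<Longrightarrow> elim p (F 1) (F 2) u v = 0"
  shows "F 1 = (\<lambda>_. 0) \<and> F 2 = (\<lambda>_. 0)"
proof (rule ccontr)
  assume nz: "\<not> (F 1 = (\<lambda>_. 0) \<and> F 2 = (\<lambda>_. 0))"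
  \<comment> \<open>The terms of \<open>F 1\<close> and \<open>F 2\<close> are ordered jointly.
    Subtracting \<open>real k * p\<close> aligns the degrees, so that \<open>L_ip\<close> carries
    leading positions in degree \<open>j\<close> to those in degree \<open>i + j\<close>.\<close>
  define S where "S = Sigma {1::nat, 2} (\<lambda>k. spt (F k))"
  have "finite S"
    unfolding S_def using fin by (intro finite_SigmaI) auto
  moreover have "S \<noteq> {}"
    using nz by (auto simp: S_def spt_def)
  ultimately obtain m where m: "m \<in> S"
    and max: "\<And>n. n \<in> S \<Longrightarrow> wt (fst (snd n)) - real (fst n) * p \<le> wt (fst (snd m)) - real (fst m) * p"
    using finite_maximizer[of S "\<lambda>n. wt (fst (snd n)) - real (fst n) * p"] by metis
  obtain k0 u1 v where m_eq: "m = (k0, u1, v)"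
    by (metis prod.exhaust)
  define u where "u = sh (- (real k0 * p)) u1"
  define T where "T = wt u"
  define c where "c = cc u"
  \<comment> \<open>The coefficient at the common leading position; it is known to be nonzero only
    for \<open>k0\<close>.\<close>
  define g where "g k = F k (sh (real k * p) u, v)" for k
  define bd where "bd k \<longleftrightarrow> (\<forall>u v. F k (u, v) \<noteq> 0 \<longrightarrow> wt u \<le> T + real k * p)" for k
  have k0: "k0 \<in> {1, 2}" and F0: "F k0 (u1, v) \<noteq> 0"
    using m m_eq by (auto simp: S_def spt_def)
  have g0: "g k0 \<noteq> 0"
    using F0 by (simp add: g_def u_def)
  have uv: "wt u + wt v = 0" "cc u = cc v"
    using wts[OF k0 F0] by (simp_all add: u_def)
  have bd12: "bd k" if "k \<in> {1, 2}" for k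
    unfolding bd_def
  proof (intro allI impI)
    fix a b assume "F k (a, b) \<noteq> 0"
    then show "wt a \<le> T + real k * p"
      using max[of "(k, a, b)"] that m_eq by (simp add: S_def spt_def T_def u_def)
  qed
  have bdD: "F k (a, b) = 0" if "bd k" "wt a > T + real k * p" for k a b
    using that unfolding bd_def by (metis not_le)
  \<comment> \<open>Beyond the bound both actions in the cocycle identity vanish, and
    \<open>i \<noteq> j\<close> permits division by the remaining coefficient.\<close>
  have bd_add: "bd (i + j)" if "bd i" "bd j" "i > 0" "j > 0" "i \<noteq> j" for i j
    unfolding bd_def
  proof (intro allI impI, rule ccontr)
    fix a b
    assume nz: "F (i + j) (a, b) \<noteq> 0" and "\<not> wt a \<le> T + real (i + j) * p"
    then have gt: "wt a > T + real i * p + real j * p"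
      by (simp add: distrib_right)
    moreover have "real i * p > 0" "real j * p > 0"
      using that \<open>p > 0\<close> by auto
    ultimately have "lact (real i * p) (F j) (a, b) = 0" "lact (real j * p) (F i) (a, b) = 0"
      using bdD[OF that(1)] bdD[OF that(2)] by (simp_all add: lact_def)
    then have "of_real ((real i - real j) * p) * F (i + j) (a, b) = 0"
      using cocycle[OF that(3,4), of "(a, b)"] by simp
    then show False
      using nz that \<open>p > 0\<close> by simp
  qed
  \<comment> \<open>At the leading position only the first factor contributes: the second one would
    need a term of \<open>F j\<close> or \<open>F i\<close> beyond its bound.\<close>
  have step: "of_real ((real i - real j) * p) * g (i + j)
      = of_real (real i * c * p - T - real j * p) * g j - of_real (real j * c * p - T - real i * p) * g i"
    if "bd i" "bd j" "i > 0" "j > 0" for i j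
  proof -
    have pos: "real i * p > 0" "real j * p > 0"
      using that \<open>p > 0\<close> by auto
    have "lact (real i * p) (F j) (sh (real (i + j) * p) u, v)
        = al (real i * p) (sh (real j * p) u) * g j"
      using bdD[OF that(2), of "sh (real (i + j) * p) u"] pos
      by (simp add: lact_def g_def distrib_right T_def)
    moreover have "lact (real j * p) (F i) (sh (real (i + j) * p) u, v)
        = al (real j * p) (sh (real i * p) u) * g i"
      using bdD[OF that(1), of "sh (real (i + j) * p) u"] pos
      by (simp add: lact_def g_def distrib_right T_def)
    ultimately show ?thesis
      using cocycle[OF that(3,4), of "(sh (real (i + j) * p) u, v)"]
      by (simp add: al_def g_def c_def T_def mult_ac diff_diff_eq)
  qed
  have bd: "bd 1" "bd 2" "bd 3" "bd 4"
    using bd12 bd_add[of 2 1] bd_add[of 3 1] by simp_all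
  have c: "c = 1 \<or> c = 1 / 2"
    unfolding c_def by (rule cc_cases)
  have "of_real (2 * c * p - T) * g 1 = of_real (c * p - T) * g 2"
  proof (rule degree_five_relation[OF c, where ?g3.0 = "g 3" and ?g4.0 = "g 4" and ?g5.0 = "g 5"])
    show "p \<noteq> 0"
      using \<open>p > 0\<close> by simp
  qed (use step[of 2 1] step[of 3 1] step[of 4 1] step[of 3 2] bd in simp_all)
  then have rel: "al (2 * p) u * g 1 = al p u * g 2"
    by (simp add: al_def c_def T_def mult_ac)
  \<comment> \<open>This value lies beyond the bound in degree 1, so only two of the three terms of
    \<open>elim\<close> survive.\<close>
  have "F 1 (sh (2 * p) u, sh (- p) v) = 0"
    by (rule bdD[OF bd(1)]) (use \<open>p > 0\<close> in \<open>simp add: T_def\<close>)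
  then have rel': "al p (sh (- p) v) * al p (sh (- (2 * p)) v) * g 2
      = - (al (2 * p) (sh (- (2 * p)) v) * al p (sh p u) * g 1)"
    using elim[OF uv] by (simp add: elim_def g_def algebra_simps add_eq_0_iff)
  \<comment> \<open>Cramer's rule for the relations \<open>rel\<close> and \<open>rel'\<close>,
    whose determinant is \<open>elim_const p u\<close>.\<close>
  have "elim_const p u * g 1 = 0" "elim_const p u * g 2 = 0"
    unfolding al_elim_const[OF uv, symmetric] using rel rel' by algebra+
  then have "g 1 = 0" "g 2 = 0"
    using elim_const_nonzero[of p u] \<open>p > 0\<close> by simp_all
  then show False
    using g0 k0 by auto
qed

section \<open>The three terms of the Yang--Baxter operator\<close>

text \<open>\<open>C1\<close>, \<open>C2\<close>, \<open>C3\<close> are the summands of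
  \<open>cYB\<close> with the bracket in the first, second, third factor, polarized to two arguments
  because \<open>L_p\<close> acts on them by the Leibniz rule.\<close>

definition C1 :: "(lbl \<times> lbl \<Rightarrow> complex) \<Rightarrow> (lbl \<times> lbl \<Rightarrow> complex) \<Rightarrow> lbl \<times> lbl \<times> lbl \<Rightarrow> complex" where
  "C1 t t' = (\<lambda>(x, y, z). pr (\<lambda>a. t (a, y)) (\<lambda>a. pr (\<lambda>b. t' (b, z)) (\<lambda>b. ssign b y * br a b x)))"

definition C2 :: "(lbl \<times> lbl \<Rightarrow> complex) \<Rightarrow> (lbl \<times> lbl \<Rightarrow> complex) \<Rightarrow> lbl \<times> lbl \<times> lbl \<Rightarrow> complex" where
  "C2 t t' = (\<lambda>(x, y, z). pr (\<lambda>a. t (x, a)) (\<lambda>a. pr (\<lambda>b. t' (b, z)) (\<lambda>b. br a b y)))"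

definition C3 :: "(lbl \<times> lbl \<Rightarrow> complex) \<Rightarrow> (lbl \<times> lbl \<Rightarrow> complex) \<Rightarrow> lbl \<times> lbl \<times> lbl \<Rightarrow> complex" where
  "C3 t t' = (\<lambda>(x, y, z). pr (\<lambda>a. t (x, a)) (\<lambda>a. pr (\<lambda>b. t' (y, b)) (\<lambda>b. ssign a y * br a b z)))"

lemma pr_cong:
  assumes "\<And>a. f a \<noteq> 0 \<Longrightarrow> h a = h' a"
  shows "pr f h = pr f h'"
  unfolding pr_def by (rule sum.cong) (use assms in \<open>auto simp: spt_def\<close>)

lemma pr_cong2:
  assumes "\<And>a b. f a \<noteq> 0 \<Longrightarrow> g b \<noteq> 0 \<Longrightarrow> k a b = k' a b"
  shows "pr f (\<lambda>a. pr g (k a)) = pr f (\<lambda>a. pr g (k' a))"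
  by (intro pr_cong) (use assms in blast)

lemma pr_swap: "pr f (\<lambda>a. pr g (\<lambda>b. k a b)) = pr g (\<lambda>b. pr f (\<lambda>a. k a b))"
proof -
  have "pr f (\<lambda>a. pr g (\<lambda>b. k a b)) = (\<Sum>a\<in>spt f. \<Sum>b\<in>spt g. f a * g b * k a b)"
    by (simp add: pr_def sum_distrib_left mult.assoc)
  also have "\<dots> = (\<Sum>b\<in>spt g. \<Sum>a\<in>spt f. f a * g b * k a b)"
    by (rule sum.swap)
  also have "\<dots> = pr g (\<lambda>b. pr f (\<lambda>a. k a b))"
    by (simp add: pr_def sum_distrib_left mult_ac)
  finally show ?thesis .
qed

lemma pr_nonzeroE:
  assumes "pr f h \<noteq> 0"
  obtains a where "f a \<noteq> 0" "h a \<noteq> 0"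
  using assms unfolding pr_def by (metis (no_types, lifting) mult_eq_0_iff sum.neutral)

lemma ssign_commute: "ssign a b = ssign b a"
  by (simp add: ssign_def mult.commute)

lemma cYB_eq_C:
  assumes "finite (spt r)"
  shows "cYB r q = C1 r r q + C2 r r q + C3 r r q"
proof (cases q)
  case (fields x y z)
  have inner: "(\<Sum>q'\<in>spt r. r (a, b) * r q' *
        (ssign (fst q') b * br a (fst q') x * bv b y * bv (snd q') z
         + bv a x * br b (fst q') y * bv (snd q') z
         + ssign (fst q') b * bv a x * bv (fst q') y * br b (snd q') z))
      = r (a, b) * (bv b y * pr (\<lambda>a'. r (a', z)) (\<lambda>a'. ssign a' b * br a a' x))
      + r (a, b) * (bv a x * pr (\<lambda>a'. r (a', z)) (\<lambda>a'. br b a' y))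
      + r (a, b) * (bv a x * pr (\<lambda>b'. r (y, b')) (\<lambda>b'. ssign y b * br b b' z))" (is "?L = ?R") for a b
  proof -
    have "?L = r (a, b) * (bv b y * (\<Sum>q'\<in>spt r. r q' * (bv (snd q') z * (ssign (fst q') b * br a (fst q') x))))
      + r (a, b) * (bv a x * (\<Sum>q'\<in>spt r. r q' * (bv (snd q') z * br b (fst q') y)))
      + r (a, b) * (bv a x * (\<Sum>q'\<in>spt r. r q' * (bv (fst q') y * (ssign (fst q') b * br b (snd q') z))))"
      by (simp add: sum_distrib_left sum.distrib[symmetric] algebra_simps)
    then show ?thesis
      by (simp add: sum_col[OF assms] sum_row[OF assms])
  qed
  have "cYB r (x, y, z) = (\<Sum>q\<in>spt r.
        r q * (bv (snd q) y * pr (\<lambda>a'. r (a', z)) (\<lambda>a'. ssign a' (snd q) * br (fst q) a' x))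
      + r q * (bv (fst q) x * pr (\<lambda>a'. r (a', z)) (\<lambda>a'. br (snd q) a' y))
      + r q * (bv (fst q) x * pr (\<lambda>b'. r (y, b')) (\<lambda>b'. ssign y (snd q) * br (snd q) b' z)))"
    unfolding cYB_def prod.case
  proof (rule sum.cong[OF refl])
    fix q :: "lbl \<times> lbl"
    show "(\<Sum>q'\<in>spt r. case q of (a, b) \<Rightarrow> case q' of (a', b') \<Rightarrow> r q * r q' *
          (ssign a' b * br a a' x * bv b y * bv b' z
           + bv a x * br b a' y * bv b' z
           + ssign a' b * bv a x * bv a' y * br b b' z))
      = r q * (bv (snd q) y * pr (\<lambda>a'. r (a', z)) (\<lambda>a'. ssign a' (snd q) * br (fst q) a' x))
      + r q * (bv (fst q) x * pr (\<lambda>a'. r (a', z)) (\<lambda>a'. br (snd q) a' y))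
      + r q * (bv (fst q) x * pr (\<lambda>b'. r (y, b')) (\<lambda>b'. ssign y (snd q) * br (snd q) b' z))"
      by (cases q) (simp only: split_beta inner fst_conv snd_conv)
  qed
  then show ?thesis
    by (simp add: fields sum.distrib sum_col[OF assms] sum_row[OF assms] C1_def C2_def C3_def ssign_commute[of y])
qed

lemma finite_spt_cYB:
  assumes "finite (spt r)"
  shows "finite (spt (cYB r))"
proof -
  have "finite (spt (C1 r r))"
  proof (rule finite_subset)
    show "spt (C1 r r) \<subseteq> (\<Union>q\<in>spt r. \<Union>q'\<in>spt r. spt (br (fst q) (fst q')) \<times> {snd q} \<times> {snd q'})"
      by (force simp: spt_def C1_def elim!: pr_nonzeroE)
  qed (use assms finite_spt_br in auto)
  moreover have "finite (spt (C2 r r))"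
  proof (rule finite_subset)
    show "spt (C2 r r) \<subseteq> (\<Union>q\<in>spt r. \<Union>q'\<in>spt r. {fst q} \<times> spt (br (snd q) (fst q')) \<times> {snd q'})"
      by (force simp: spt_def C2_def elim!: pr_nonzeroE)
  qed (use assms finite_spt_br in auto)
  moreover have "finite (spt (C3 r r))"
  proof (rule finite_subset)
    show "spt (C3 r r) \<subseteq> (\<Union>q\<in>spt r. \<Union>q'\<in>spt r. {fst q} \<times> {fst q'} \<times> spt (br (snd q) (snd q')))"
      by (force simp: spt_def C3_def elim!: pr_nonzeroE)
  qed (use assms finite_spt_br in auto)
  ultimately have "finite (spt (\<lambda>q. C1 r r q + C2 r r q + C3 r r q))"
    by (intro finite_spt_add)
  then show ?thesis
    by (simp add: cYB_eq_C[OF assms, abs_def])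
qed

text \<open>\<open>br_jacobi_Lb\<close> under a double pairing. The weight \<open>k\<close> holds
  the signs of \<open>C1\<close> and \<open>C3\<close>, which shifts preserve.\<close>

lemma pr_br_jacobi:
  "al p (sh (- p) x) * pr f (\<lambda>a. pr g (\<lambda>b. k a b * br a b (sh (- p) x)))
   = pr f (\<lambda>a. al p a * pr g (\<lambda>b. k a b * br (sh p a) b x))
     + pr f (\<lambda>a. pr g (\<lambda>b. al p b * (k a b * br a (sh p b) x)))"
proof -
  have "al p (sh (- p) x) * pr f (\<lambda>a. pr g (\<lambda>b. k a b * br a b (sh (- p) x)))
      = pr f (\<lambda>a. pr g (\<lambda>b. k a b * (al p (sh (- p) x) * br a b (sh (- p) x))))"
    by (simp add: pr_smul_right[symmetric] mult_ac)
  also have "\<dots> = pr f (\<lambda>a. pr g (\<lambda>b. al p a * (k a b * br (sh p a) b x)) + pr g (\<lambda>b. al p b * (k a b * br a (sh p b) x)))"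
    by (simp add: br_jacobi_Lb pr_add_right[symmetric] algebra_simps)
  finally show ?thesis
    by (simp add: pr_add_right pr_smul_right)
qed

text \<open>The Jacobi identity handles the bracketed factor, and each free factor belongs to one of
  the two arguments.\<close>

lemma lact3_C1:
  assumes "finite (spt t)" "finite (spt t')"
  shows "lact3 p (C1 t t') q = C1 (lact p t) t' q + C1 t (lact p t') q"
proof (cases q)
  case (fields x y z)
  show ?thesis
    using pr_br_jacobi[of p x "\<lambda>a. t (a, y)" "\<lambda>b. t' (b, z)" "\<lambda>a b. ssign b y"]
    by (simp add: fields lact3_def C1_def pr_col_lact assms pr_add_right pr_smul_right)
qed

lemma lact3_C2:
  assumes "finite (spt t)" "finite (spt t')"
  shows "lact3 p (C2 t t') q = C2 (lact p t) t' q + C2 t (lact p t') q"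
proof (cases q)
  case (fields x y z)
  show ?thesis
    using pr_br_jacobi[of p y "\<lambda>a. t (x, a)" "\<lambda>b. t' (b, z)" "\<lambda>a b. 1"]
    by (simp add: fields lact3_def C2_def pr_col_lact pr_row_lact assms pr_add_right pr_smul_right)
qed

lemma lact3_C3:
  assumes "finite (spt t)" "finite (spt t')"
  shows "lact3 p (C3 t t') q = C3 (lact p t) t' q + C3 t (lact p t') q"
proof (cases q)
  case (fields x y z)
  show ?thesis
    using pr_br_jacobi[of p z "\<lambda>a. t (x, a)" "\<lambda>b. t' (y, b)" "\<lambda>a b. ssign a y"]
    by (simp add: fields lact3_def C3_def pr_row_lact assms pr_add_right
        pr_smul_right[where k = "al p (sh (- p) y)"])
qed

definition even_tensor :: "(lbl \<times> lbl \<Rightarrow> complex) \<Rightarrow> bool" where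
  "even_tensor t \<longleftrightarrow> (\<forall>a b. t (a, b) \<noteq> 0 \<longrightarrow> par a = par b)"

definition skew_tensor :: "(lbl \<times> lbl \<Rightarrow> complex) \<Rightarrow> bool" where
  "skew_tensor t \<longleftrightarrow> (\<forall>a b. t (a, b) = - ssign a b * t (b, a))"

lemma even_tensorD: "even_tensor t \<Longrightarrow> t (a, b) \<noteq> 0 \<Longrightarrow> par a = par b"
  by (auto simp: even_tensor_def)

lemma skew_tensorD: "skew_tensor t \<Longrightarrow> t (a, b) = - ssign a b * t (b, a)"
  unfolding skew_tensor_def by blast

text \<open>Rewriting columns as rows brings the cyclic images of \<open>C1\<close>,
  \<open>C2\<close>, \<open>C3\<close> to a common form, so that only signs remain to be
  compared.\<close>

lemma pr_col_skew:
  assumes "skew_tensor t" "finite (spt t)"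
  shows "pr (\<lambda>a. t (a, x)) h = pr (\<lambda>a. t (x, a)) (\<lambda>a. - ssign a x * h a)"
proof -
  have "(\<lambda>a. t (a, x)) = (\<lambda>a. (- ssign a x) * t (x, a))"
    using assms(1) unfolding skew_tensor_def by blast
  then show ?thesis
    using pr_mult[OF finite_spt_row[OF assms(2)], of "\<lambda>a. - ssign a x" x h] by simp
qed

text \<open>On even skew tensors \<open>\<xi>\<close> maps \<open>C1 t t'\<close> to \<open>C3 t t'\<close> to \<open>C2 t' t\<close> and back.  Therefore the cyclic sum of \<open>C2 t r + C3 t r\<close> is the polarization of \<open>c(r)\<close> at \<open>(t, r)\<close>, and for
  \<open>t = L\<^sub>p \<circ> r\<close> this is \<open>L\<^sub>p \<circ> c(r)\<close>.\<close>

lemma xi_C1: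
  assumes "even_tensor t" "even_tensor t'" "skew_tensor t" "skew_tensor t'" "finite (spt t)" "finite (spt t')"
  shows "xi (C1 t t') = C3 t t'"
proof (rule ext, safe)
  fix x y z
  have "xi (C1 t t') (x, y, z) = pr (\<lambda>a. t (x, a)) (\<lambda>a. pr (\<lambda>b. t' (y, b)) (\<lambda>b.
      (-1) ^ (par z * (par x + par y)) * (- ssign a x * (- ssign b y * (ssign b x * br a b z)))))"
    by (simp only: xi_def C1_def prod.case pr_col_skew assms pr_smul_right)
  also have "\<dots> = C3 t t' (x, y, z)"
    unfolding C3_def prod.case
  proof (rule pr_cong2)
    fix a b
    assume "t (x, a) \<noteq> 0" "t' (y, b) \<noteq> 0"
    then have "par x = par a" "par y = par b"
      using assms by (auto dest: even_tensorD)
    \<comment> \<open>Evenness fixes the parities of \<open>x\<close> and \<open>y\<close>, a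
      nonzero bracket that of \<open>z\<close>; only the four parity cases of \<open>a\<close> and
      \<open>b\<close> are left.\<close>
    then show "(-1) ^ (par z * (par x + par y)) * (- ssign a x * (- ssign b y * (ssign b x * br a b z)))
        = ssign a y * br a b z"
      using par_cases[of a] par_cases[of b] br_parity[of a b z]
      by (cases "br a b z = 0") (auto simp: ssign_def)
  qed
  finally show "xi (C1 t t') (x, y, z) = C3 t t' (x, y, z)" .
qed

lemma xi_C3:
  assumes "even_tensor t" "even_tensor t'" "skew_tensor t" "skew_tensor t'" "finite (spt t)" "finite (spt t')"
  shows "xi (C3 t t') = C2 t' t"
proof (rule ext, safe)
  fix x y z
  \<comment> \<open>The shift puts the slice of \<open>t\<close> at \<open>z\<close> in front.
    Exchanging the sums and reversing the bracket by super-antisymmetry makes \<open>t\<close> and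
    \<open>t'\<close> change places.\<close>
  have "xi (C3 t t') (x, y, z) = pr (\<lambda>b. t' (x, b)) (\<lambda>b. pr (\<lambda>a. t (z, a)) (\<lambda>a.
      (-1) ^ (par z * (par x + par y)) * (ssign a x * br a b y)))"
    by (simp only: xi_def C3_def prod.case pr_swap[of "\<lambda>a. t (z, a)"]) (simp only: pr_smul_right)
  also have "\<dots> = pr (\<lambda>b. t' (x, b)) (\<lambda>b. pr (\<lambda>a. t (z, a)) (\<lambda>a. - ssign a z * br b a y))"
  proof (rule pr_cong2)
    fix b a
    assume "t' (x, b) \<noteq> 0" "t (z, a) \<noteq> 0"
    then have "par z = par a" "par x = par b"
      using assms by (auto dest: even_tensorD)
    then show "(-1) ^ (par z * (par x + par y)) * (ssign a x * br a b y) = - ssign a z * br b a y"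
      using par_cases[of a] par_cases[of b] br_parity[of a b y] br_swap[of b a y]
      by (cases "br a b y = 0") (auto simp: ssign_def)
  qed
  also have "\<dots> = C2 t' t (x, y, z)"
    by (simp only: C2_def prod.case pr_col_skew assms)
  finally show "xi (C3 t t') (x, y, z) = C2 t' t (x, y, z)" .
qed

lemma xi_C2:
  assumes "even_tensor t" "even_tensor t'" "skew_tensor t" "skew_tensor t'" "finite (spt t)" "finite (spt t')"
  shows "xi (C2 t' t) = C1 t t'"
proof (rule ext, safe)
  fix x y z
  have "xi (C2 t' t) (x, y, z) = pr (\<lambda>a. t (y, a)) (\<lambda>a. pr (\<lambda>b. t' (z, b)) (\<lambda>b.
      (-1) ^ (par z * (par x + par y)) * (- ssign a y * br b a x)))"
    by (simp only: xi_def C2_def prod.case pr_col_skew assms pr_smul_right pr_swap[of "\<lambda>a. t' (z, a)"])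
  also have "\<dots> = pr (\<lambda>a. t (y, a)) (\<lambda>a. pr (\<lambda>b. t' (z, b)) (\<lambda>b. - ssign a y * (- ssign b z * (ssign b y * br a b x))))"
  proof (rule pr_cong2)
    fix a b
    assume "t (y, a) \<noteq> 0" "t' (z, b) \<noteq> 0"
    then have "par y = par a" "par z = par b"
      using assms by (auto dest: even_tensorD)
    then show "(-1) ^ (par z * (par x + par y)) * (- ssign a y * br b a x)
        = - ssign a y * (- ssign b z * (ssign b y * br a b x))"
      using par_cases[of a] par_cases[of b] br_parity[of a b x] br_swap[of b a x]
      by (cases "br a b x = 0") (auto simp: ssign_def)
  qed
  also have "\<dots> = C1 t t' (x, y, z)"
    by (simp only: C1_def prod.case pr_col_skew assms pr_smul_right)
  finally show "xi (C2 t' t) (x, y, z) = C1 t t' (x, y, z)" .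
qed

text \<open>The two terms of the action of \<open>w\<close> on \<open>r\<close> yield
  \<open>C2\<close> and \<open>C3\<close>. Only second labels occurring in \<open>t\<close> matter,
  since \<open>D\<close> is controlled on valid labels only.\<close>

lemma idD_eq_C:
  assumes "finite (spt t)" "finite (spt r)"
    and D: "\<And>x w. t (x, w) \<noteq> 0 \<Longrightarrow> D (bv w) = act (bv w) r"
  shows "idD D t = (\<lambda>q. C2 t r q + C3 t r q)"
proof (rule ext, safe)
  fix x y z
  have "idD D t (x, y, z) = (\<Sum>q\<in>spt t. t q * (bv (fst q) x * D (bv (snd q)) (y, z)))"
    unfolding idD_def prod.case by (rule sum.cong) (auto simp: bv_def)
  also have "\<dots> = pr (\<lambda>w. t (x, w)) (\<lambda>w. D (bv w) (y, z))"
    by (simp add: sum_row assms)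
  also have "\<dots> = pr (\<lambda>w. t (x, w)) (\<lambda>w. act (bv w) r (y, z))"
    by (rule pr_cong) (simp add: D)
  also have "\<dots> = C2 t r (x, y, z) + C3 t r (x, y, z)"
    by (simp add: act_bv assms C2_def C3_def pr_add_right pr_smul_right)
  finally show "idD D t (x, y, z) = C2 t r (x, y, z) + C3 t r (x, y, z)" .
qed

section \<open>Super-bialgebra structures\<close>

lemma brk_bv: "brk (bv a) (bv b) = br a b"
  by (simp add: brk_def)

lemma even_tensor_iff_homog2: "even_tensor t \<longleftrightarrow> homog2 0 t"
proof -
  have "(par a + par b) mod 2 = 0 \<longleftrightarrow> par a = par b" for a b
    using par_cases[of a] par_cases[of b] by auto
  then show ?thesis
    by (auto simp: even_tensor_def homog2_def spt_def)
qed

lemma even_tensor_lact: "even_tensor t \<Longrightarrow> even_tensor (lact p t)"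
  unfolding even_tensor_def
proof (intro allI impI)
  fix a b
  assume "\<forall>a b. t (a, b) \<noteq> 0 \<longrightarrow> par a = par b" and "lact p t (a, b) \<noteq> 0"
  moreover from this have "t (sh (- p) a, b) \<noteq> 0 \<or> t (a, sh (- p) b) \<noteq> 0"
    by (auto simp: lact_def)
  ultimately have "par (sh (- p) a) = par b \<or> par a = par (sh (- p) b)"
    by blast
  then show "par a = par b"
    by simp
qed

lemma even_tensor_diff: "even_tensor t \<Longrightarrow> even_tensor t' \<Longrightarrow> even_tensor (\<lambda>q. t q - t' q)"
  unfolding even_tensor_def by (metis diff_0_right)

locale super_bialgebra =
  fixes \<Gamma> :: "real set" and s :: real and D :: "(lbl \<Rightarrow> complex) \<Rightarrow> lbl \<times> lbl \<Rightarrow> complex"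
  assumes subgroup: "add_subgroup \<Gamma>" and bialgebra: "lie_super_bialgebra \<Gamma> s D"
begin

lemma add_mem: "p \<in> \<Gamma> \<Longrightarrow> q \<in> \<Gamma> \<Longrightarrow> p + q \<in> \<Gamma>"
  and neg_mem: "p \<in> \<Gamma> \<Longrightarrow> - p \<in> \<Gamma>"
  and zero_mem: "0 \<in> \<Gamma>"
  using subgroup by (auto simp: add_subgroup_def)

lemma multiple_mem: "p \<in> \<Gamma> \<Longrightarrow> real k * p \<in> \<Gamma>"
  by (induction k) (simp_all add: zero_mem add_mem distrib_right)

lemma valid_sh: "valid \<Gamma> s a \<Longrightarrow> p \<in> \<Gamma> \<Longrightarrow> valid \<Gamma> s (sh p a)"
  using add_mem[of "wt a - s" p] by (cases a) (auto simp: add_mem add_diff_eq diff_add_eq)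

lemma valid_sh_iff: "p \<in> \<Gamma> \<Longrightarrow> valid \<Gamma> s (sh p a) \<longleftrightarrow> valid \<Gamma> s a"
  using valid_sh[of a p] valid_sh[of "sh p a" "- p"] neg_mem by auto

lemma inL_bv: "valid \<Gamma> s a \<Longrightarrow> inL \<Gamma> s (bv a)"
  by (simp add: inL_def)

lemma inL2_iff: "inL2 \<Gamma> s t \<longleftrightarrow> finite (spt t) \<and> (\<forall>a b. t (a, b) \<noteq> 0 \<longrightarrow> valid \<Gamma> s a \<and> valid \<Gamma> s b)"
  by (auto simp: inL2_def spt_def)

lemma inL2_finite: "inL2 \<Gamma> s t \<Longrightarrow> finite (spt t)"
  by (simp add: inL2_def)

lemma inL2_lact:
  assumes "inL2 \<Gamma> s t" "p \<in> \<Gamma>"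
  shows "inL2 \<Gamma> s (lact p t)"
  unfolding inL2_iff
proof (intro conjI allI impI)
  show "finite (spt (lact p t))"
    using assms by (simp add: finite_spt_lact inL2_finite)
  fix a b assume "lact p t (a, b) \<noteq> 0"
  then have "t (sh (- p) a, b) \<noteq> 0 \<or> t (a, sh (- p) b) \<noteq> 0"
    by (auto simp: lact_def)
  then show "valid \<Gamma> s a" "valid \<Gamma> s b"
    using assms neg_mem valid_sh_iff unfolding inL2_iff by blast+
qed

lemma inL2_diff: "inL2 \<Gamma> s t \<Longrightarrow> inL2 \<Gamma> s t' \<Longrightarrow> inL2 \<Gamma> s (\<lambda>q. t q - t' q)"
  unfolding inL2_iff by (metis diff_0_right finite_spt_diff)

lemma D_inL2: "inL \<Gamma> s u \<Longrightarrow> inL2 \<Gamma> s (D u)"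
  using bialgebra by (simp add: lie_super_bialgebra_def)

lemma D_add: "inL \<Gamma> s u \<Longrightarrow> inL \<Gamma> s v \<Longrightarrow> D (\<lambda>a. u a + v a) = (\<lambda>p. D u p + D v p)"
  using bialgebra by (simp add: lie_super_bialgebra_def)

lemma D_smul: "inL \<Gamma> s u \<Longrightarrow> D (smul c u) = smul c (D u)"
  using bialgebra by (simp add: lie_super_bialgebra_def)

lemma D_skew: "inL \<Gamma> s u \<Longrightarrow> in_im_1_minus_tau \<Gamma> s (D u)"
  using bialgebra by (simp add: lie_super_bialgebra_def)

lemma D_co_jacobi: "inL \<Gamma> s u \<Longrightarrow> idD D (D u) q + xi (idD D (D u)) q + xi (xi (idD D (D u))) q = 0"
  using bialgebra unfolding lie_super_bialgebra_def Let_def by metis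

lemma even_tensor_D_Lb:
  assumes "p \<in> \<Gamma>"
  shows "even_tensor (D (bv (Lb p)))"
proof -
  have "inL \<Gamma> s (bv (Lb p))" "homog 0 (bv (Lb p))"
    using assms by (simp_all add: inL_bv homog_def)
  then show ?thesis
    using bialgebra unfolding even_tensor_iff_homog2 lie_super_bialgebra_def by (metis zero_less_numeral)
qed

lemma D_cocycle:
  assumes "p \<in> \<Gamma>" "valid \<Gamma> s a"
  shows "lact p (D (bv a)) q - act (bv a) (D (bv (Lb p))) q = al p a * D (bv (sh p a)) q"
proof -
  have L: "inL \<Gamma> s (bv (Lb p))" "inL \<Gamma> s (bv a)" "inL \<Gamma> s (bv (sh p a))"
    using assms by (simp_all add: inL_bv valid_sh)
  have h: "homog 0 (bv (Lb p))" "homog (par a) (bv a)"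
    by (simp_all add: homog_def)
  have "par a < 2"
    using par_cases[of a] by auto
  then have "D (brk (bv (Lb p)) (bv a))
      = (\<lambda>q. act (bv (Lb p)) (D (bv a)) q - (-1) ^ (0 * par a) * act (bv a) (D (bv (Lb p))) q)"
    using bialgebra L(1,2) h unfolding lie_super_bialgebra_def by (metis zero_less_numeral)
  moreover have "D (brk (bv (Lb p)) (bv a)) = smul (al p a) (D (bv (sh p a)))"
    using L by (simp add: brk_bv br_Lb D_smul)
  ultimately have "smul (al p a) (D (bv (sh p a))) q = act (bv (Lb p)) (D (bv a)) q - act (bv a) (D (bv (Lb p))) q"
    by simp
  then show ?thesis
    using L by (simp add: smul_def act_bv_Lb inL2_finite D_inL2)
qed

section \<open>The defect of the cobracket from a coboundary\<close>

text \<open>The aim is an even \<open>r\<close> for which this vanishes; for even \<open>r\<close>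
  the coboundary carries no sign.\<close>

definition dd :: "(lbl \<times> lbl \<Rightarrow> complex) \<Rightarrow> lbl \<Rightarrow> lbl \<times> lbl \<Rightarrow> complex" where
  "dd r a = (\<lambda>q. D (bv a) q - act (bv a) r q)"

lemma finite_spt_dd: "finite (spt r) \<Longrightarrow> valid \<Gamma> s a \<Longrightarrow> finite (spt (dd r a))"
  unfolding dd_def
  by (rule finite_spt_diff) (auto intro: finite_spt_act_bv inL2_finite[OF D_inL2[OF inL_bv]])

text \<open>The cobracket satisfies this by compatibility and the coboundary by the module law
  \<open>lact_act\<close>.\<close>

lemma dd_cocycle:
  assumes "finite (spt r)" "p \<in> \<Gamma>" "valid \<Gamma> s a"
  shows "lact p (dd r a) q - act (bv a) (dd r (Lb p)) q = al p a * dd r (sh p a) q"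
proof -
  have L: "finite (spt (D (bv (Lb p))))"
    using assms by (simp add: inL2_finite D_inL2 inL_bv)
  have "lact p (dd r a) q = lact p (D (bv a)) q - lact p (act (bv a) r) q"
    by (cases q) (simp add: dd_def lact_def algebra_simps)
  moreover have "act (bv a) (dd r (Lb p)) q = act (bv a) (D (bv (Lb p))) q - act (bv a) (lact p r) q"
    unfolding dd_def act_bv_Lb[OF assms(1)] using L assms(1) by (simp add: act_bv_diff finite_spt_lact)
  moreover have "al p a * dd r (sh p a) q = al p a * D (bv (sh p a)) q - al p a * act (bv (sh p a)) r q"
    by (simp add: dd_def right_diff_distrib)
  ultimately show ?thesis
    using D_cocycle[OF assms(2,3), of q] lact_act[OF assms(1), of p a q] by algebra
qed

lemma dd_cocycle_Lb:
  assumes "finite (spt r)" "p \<in> \<Gamma>" "q \<in> \<Gamma>"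
  shows "lact p (dd r (Lb q)) x - lact q (dd r (Lb p)) x = of_real (p - q) * dd r (Lb (p + q)) x"
  using dd_cocycle[OF assms(1,2), of "Lb q" x] assms
  by (simp add: act_bv_Lb finite_spt_dd al_def add.commute)

lemma dd_hom:
  assumes "finite (spt r)" "p \<in> \<Gamma>" "valid \<Gamma> s a" "dd r (Lb p) = (\<lambda>_. 0)"
  shows "lact p (dd r a) q = al p a * dd r (sh p a) q"
proof -
  have "act (bv a) (\<lambda>_. 0) q = 0"
    by (simp add: act_def spt_def)
  then show ?thesis
    using dd_cocycle[OF assms(1-3), of q] assms(4) by simp
qed

lemma lact_0: "lact 0 t (u, v) = - of_real (wt u + wt v) * t (u, v)"
  by (simp add: lact_def al_def algebra_simps)

text \<open>A cocycle vanishing at \<open>L_0\<close> commutes with \<open>L_0\<close>, which acts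
  as minus the total weight.\<close>

lemma dd_weight:
  assumes "finite (spt r)" "valid \<Gamma> s a" "dd r (Lb 0) = (\<lambda>_. 0)" "dd r a (u, v) \<noteq> 0"
  shows "wt u + wt v = wt a"
proof -
  have "- of_real (wt u + wt v) * dd r a (u, v) = al 0 a * dd r (sh 0 a) (u, v)"
    using dd_hom[OF assms(1) zero_mem assms(2,3), of "(u, v)"] by (simp only: lact_0)
  moreover have "al 0 a = - of_real (wt a)"
    by (simp add: al_def)
  ultimately have "complex_of_real (wt u + wt v) * dd r a (u, v) = of_real (wt a) * dd r a (u, v)"
    by (simp only: sh_0 mult_minus_left neg_equal_iff_equal)
  then show ?thesis
    by (simp only: mult_right_cancel[OF assms(4)] of_real_eq_iff)
qed

lemma even_tensor_dd_Lb: "even_tensor r \<Longrightarrow> finite (spt r) \<Longrightarrow> p \<in> \<Gamma> \<Longrightarrow> even_tensor (dd r (Lb p))"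
  unfolding dd_def by (simp add: act_bv_Lb even_tensor_diff even_tensor_D_Lb even_tensor_lact)

lemma inL2_dd_Lb: "inL2 \<Gamma> s r \<Longrightarrow> p \<in> \<Gamma> \<Longrightarrow> inL2 \<Gamma> s (dd r (Lb p))"
  unfolding dd_def by (simp add: act_bv_Lb inL2_finite inL2_diff inL2_lact D_inL2 inL_bv)

section \<open>Normalization at \<open>L_0\<close>, \<open>L_p\<close> and
  \<open>L_2p\<close>\<close>

lemma normalize_L0:
  assumes p: "p \<in> \<Gamma>" "p > 0"
  obtains r where "inL2 \<Gamma> s r" "even_tensor r" "dd r (Lb 0) = (\<lambda>_. 0)"
proof
  let ?D0 = "D (bv (Lb 0))"
  \<comment> \<open>\<open>L_0\<close> acts on weight \<open>w\<close> as \<open>- w\<close>;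
    dividing by \<open>- w\<close> removes the part of \<open>?D0\<close> of nonzero weight.\<close>
  define r where "r = (\<lambda>(u, v). if wt u + wt v = 0 then 0 else - ?D0 (u, v) / of_real (wt u + wt v))"
  have D0: "inL2 \<Gamma> s ?D0"
    by (simp add: D_inL2 inL_bv zero_mem)
  have r_nz: "?D0 (u, v) \<noteq> 0" if "r (u, v) \<noteq> 0" for u v
    using that by (auto simp: r_def split: if_splits)
  then have "spt r \<subseteq> spt ?D0"
    by (auto simp: spt_def)
  then have fin: "finite (spt r)"
    using D0 inL2_finite finite_subset by blast
  show "inL2 \<Gamma> s r"
    using fin r_nz D0 unfolding inL2_iff by blast
  show "even_tensor r"
    using r_nz even_tensor_D_Lb[OF zero_mem] unfolding even_tensor_def by blast
  have wt0: "dd r (Lb 0) (u, v) = 0" if "wt u + wt v \<noteq> 0" for u v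
  proof -
    have "dd r (Lb 0) (u, v) = ?D0 (u, v) + of_real (wt u + wt v) * r (u, v)"
      unfolding dd_def act_bv_Lb[OF fin] lact_0 by (simp del: of_real_add)
    then show ?thesis
      using that by (simp add: r_def del: of_real_add)
  qed
  have inv: "lact m (dd r (Lb 0)) = (\<lambda>_. 0)" if "m \<in> \<Gamma>" for m
  proof (rule ext, safe)
    fix u v
    show "lact m (dd r (Lb 0)) (u, v) = 0"
    proof (cases "wt u + wt v = m")
      \<comment> \<open>At total weight \<open>m\<close> the two terms of the cocycle identity
        involving \<open>dd r (Lb m)\<close> agree, which leaves \<open>lact m (dd r (Lb 0))\<close>
        equal to zero.\<close>
      case True
      then show ?thesis
        using dd_cocycle_Lb[OF fin zero_mem that, of "(u, v)"] by (simp add: lact_0 flip: of_real_add)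
    next
      case False
      then show ?thesis
        by (simp add: lact_def wt0)
    qed
  qed
  show "dd r (Lb 0) = (\<lambda>_. 0)"
  proof (rule lact_invariant_zero)
    show "finite (spt (dd r (Lb 0)))"
      using fin by (simp add: finite_spt_dd zero_mem)
    show "lact p (dd r (Lb 0)) = (\<lambda>_. 0)" "lact (2 * p) (dd r (Lb 0)) = (\<lambda>_. 0)"
      using inv[OF p(1)] inv[OF multiple_mem[OF p(1), of 2]] by simp_all
  qed (use p in simp)
qed

lemma normalize_L1_L2:
  assumes p: "p \<in> \<Gamma>" "p > 0"
  obtains r where "inL2 \<Gamma> s r" "even_tensor r" "dd r (Lb 0) = (\<lambda>_. 0)"
    "dd r (Lb p) = (\<lambda>_. 0)" "dd r (Lb (2 * p)) = (\<lambda>_. 0)"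
proof -
  obtain r0 where r0: "inL2 \<Gamma> s r0" "even_tensor r0" "dd r0 (Lb 0) = (\<lambda>_. 0)"
    using normalize_L0[OF p] by blast
  note fin0 = inL2_finite[OF r0(1)]
  have p2: "2 * p \<in> \<Gamma>"
    using multiple_mem[OF p(1), of 2] by simp
  define f1 f2 where "f1 = dd r0 (Lb p)" and "f2 = dd r0 (Lb (2 * p))"
  \<comment> \<open>Subtracting \<open>m\<close> from \<open>r0\<close> adds the coboundary of
    \<open>m\<close> to the defect, so the minus sign makes \<open>elim\<close> vanish afterwards.
    Having weight zero, \<open>m\<close> does not disturb the value at \<open>L_0\<close>.\<close>
  define m where "m = (\<lambda>(u, v). if wt u + wt v = 0 \<and> cc u = cc v then - elim p f1 f2 u v / elim_const p u else 0)"
  have f: "inL2 \<Gamma> s f1" "inL2 \<Gamma> s f2"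
    using r0 p p2 by (simp_all add: f1_def f2_def inL2_dd_Lb)
  have m_nz: "f2 (sh (2 * p) u, v) \<noteq> 0 \<or> f1 (sh (2 * p) u, sh (- p) v) \<noteq> 0 \<or> f1 (sh p u, v) \<noteq> 0"
    and m_wt: "wt u + wt v = 0" and m_cc: "cc u = cc v"
    if "m (u, v) \<noteq> 0" for u v
    using that by (auto simp: m_def elim_def split: if_splits)
  have "spt m \<subseteq> spt (\<lambda>q. f2 (sh (2 * p) (fst q), snd q)) \<union> spt (\<lambda>q. f1 (sh (2 * p) (fst q), sh (- p) (snd q)))
      \<union> spt (\<lambda>q. f1 (sh p (fst q), snd q))"
    using m_nz by (force simp: spt_def)
  moreover have inj: "inj (\<lambda>q. (sh i (fst q), sh j (snd q)))" for i j
    by (auto simp: inj_def sh_eq_iff)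
  have "finite (spt (\<lambda>q. f2 (sh (2 * p) (fst q), snd q)) \<union> spt (\<lambda>q. f1 (sh (2 * p) (fst q), sh (- p) (snd q)))
      \<union> spt (\<lambda>q. f1 (sh p (fst q), snd q)))"
    using finite_spt_reindex[OF f(2)[THEN inL2_finite] inj[of "2 * p" 0]]
      finite_spt_reindex[OF f(1)[THEN inL2_finite] inj[of "2 * p" "- p"]]
      finite_spt_reindex[OF f(1)[THEN inL2_finite] inj[of p 0]]
    by simp
  ultimately have finm: "finite (spt m)"
    by (rule finite_subset)
  have inm: "inL2 \<Gamma> s m"
    unfolding inL2_iff
  proof (intro conjI allI impI)
    fix u v assume "m (u, v) \<noteq> 0"
    from m_nz[OF this] show "valid \<Gamma> s u" "valid \<Gamma> s v"
      using f p(1) p2 neg_mem valid_sh_iff unfolding inL2_iff by blast+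
  qed fact
  have evm: "even_tensor m"
    unfolding even_tensor_def using m_cc cc_eq_iff by blast
  define r where "r = (\<lambda>q. r0 q - m q)"
  have r: "inL2 \<Gamma> s r" "even_tensor r"
    unfolding r_def using r0 inm evm by (simp_all add: inL2_diff even_tensor_diff)
  note fin = inL2_finite[OF r(1)]
  have dd_r: "dd r (Lb k) q = dd r0 (Lb k) q + lact k m q" for k q
    unfolding dd_def r_def by (simp add: act_bv_diff fin0 finm act_bv_Lb)
  have L0: "dd r (Lb 0) = (\<lambda>_. 0)"
  proof (rule ext, safe)
    fix u v
    show "dd r (Lb 0) (u, v) = 0"
      using m_wt[of u v] by (cases "m (u, v) = 0") (simp_all add: dd_r r0(3) lact_0 flip: of_real_add)
  qed
  define F where "F k = dd r (Lb (real k * p))" for k :: nat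
  have mem: "real k * p \<in> \<Gamma>" for k
    using p(1) by (rule multiple_mem)
  have "F 1 = (\<lambda>_. 0) \<and> F 2 = (\<lambda>_. 0)"
  proof (rule positive_cocycle_zero[OF p(2)])
    show "finite (spt (F 1))" "finite (spt (F 2))"
      unfolding F_def using fin p(1) p2 by (simp_all add: finite_spt_dd)
    show "lact (real i * p) (F j) q - lact (real j * p) (F i) q = of_real ((real i - real j) * p) * F (i + j) q"
      for i j q
      using dd_cocycle_Lb[OF fin mem[of i] mem[of j], of q] by (simp add: F_def algebra_simps)
    show "wt u + wt v = real k * p \<and> cc u = cc v" if "F k (u, v) \<noteq> 0" for k u v
      using that dd_weight[OF fin _ L0, of "Lb (real k * p)" u v] even_tensor_dd_Lb[OF r(2) fin mem[of k]] mem[of k]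
      by (auto simp: F_def even_tensor_def cc_eq_iff)
    show "elim p (F 1) (F 2) u v = 0" if uv: "wt u + wt v = 0" "cc u = cc v" for u v
    proof -
      have "elim p (F 1) (F 2) u v = elim p f1 f2 u v + elim p (lact p m) (lact (2 * p) m) u v"
        by (simp add: F_def dd_r f1_def f2_def elim_def algebra_simps)
      also have "\<dots> = elim p f1 f2 u v + elim_const p u * m (u, v)"
        by (simp only: elim_lact[OF uv])
      also have "\<dots> = 0"
        using elim_const_nonzero[of p u] p(2) uv by (simp add: m_def)
      finally show ?thesis .
    qed
  qed
  then have "dd r (Lb p) = (\<lambda>_. 0)" "dd r (Lb (2 * p)) = (\<lambda>_. 0)"
    by (simp_all add: F_def)
  then show ?thesis
    using that r L0 by blast
qed

section \<open>Vanishing of the normalized defect\<close>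

lemma dd_zero:
  assumes r: "finite (spt r)" and p: "p \<in> \<Gamma>" "p > 0"
    and L0: "dd r (Lb 0) = (\<lambda>_. 0)" and L12: "dd r (Lb p) = (\<lambda>_. 0)" "dd r (Lb (2 * p)) = (\<lambda>_. 0)"
    and a: "valid \<Gamma> s a"
  shows "dd r a = (\<lambda>_. 0)"
proof -
  have pos: "dd r (Lb (real k * p)) = (\<lambda>_. 0)" if "k > 0" for k
    using that
  proof (induction k rule: less_induct)
    case (less k)
    show ?case
    proof (cases "k \<le> 2")
      case True
      then have "k = 1 \<or> k = 2"
        using less.prems by auto
      then show ?thesis
        using L12 by auto
    next
      case False
      then have IH: "dd r (Lb (real (k - 1) * p)) = (\<lambda>_. 0)"
        by (intro less.IH) auto
      \<comment> \<open>The coefficient \<open>(2 - k) * p\<close> of this bracket is nonzero only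
        for \<open>k \<noteq> 2\<close>, hence \<open>L_2p\<close> is a separate base case.\<close>
      have eq: "p + real (k - 1) * p = real k * p" "p \<noteq> real (k - 1) * p"
        using False p(2) by (auto simp: of_nat_diff algebra_simps)
      have "of_real (p - real (k - 1) * p) * dd r (Lb (real k * p)) q = 0" for q
        using dd_cocycle_Lb[OF r p(1) multiple_mem[OF p(1), of "k - 1"], of q]
        unfolding IH L12(1) eq(1) by (simp add: lact_def split_beta)
      then show ?thesis
        using eq(2) by auto
    qed
  qed
  \<comment> \<open>The direction \<open>p'\<close> is a parameter: \<open>p\<close> treats the
    negative indices, and then \<open>- p\<close>, whose multiples are covered by these, treats the
    positive ones.\<close>
  have half: "dd r b = (\<lambda>_. 0)"
    if "p' \<in> \<Gamma>" "wt b * p' < 0" "valid \<Gamma> s b" and L: "\<And>k. k > 0 \<Longrightarrow> dd r (Lb (real k * p')) = (\<lambda>_. 0)" for p' b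
  proof (rule hom_zero[where p = p'])
    show "finite (spt (dd r b))"
      using r that by (simp add: finite_spt_dd)
    show "lact (real j * p') (dd r (sh (real k * p') b)) q
        = al (real j * p') (sh (real k * p') b) * dd r (sh ((real j + real k) * p') b) q" if "j > 0" for j k q
      using dd_hom[OF r multiple_mem[OF \<open>p' \<in> \<Gamma>\<close>] valid_sh[OF \<open>valid \<Gamma> s b\<close> multiple_mem[OF \<open>p' \<in> \<Gamma>\<close>]] L[OF that]]
      by (simp add: distrib_right)
    show "wt u + wt v = wt b" if "dd r b (u, v) \<noteq> 0" for u v
      using r \<open>valid \<Gamma> s b\<close> L0 that by (rule dd_weight)
  qed fact
  have neg: "dd r b = (\<lambda>_. 0)" if "wt b < 0" "valid \<Gamma> s b" for b
    using half[OF p(1) _ that(2) pos] that(1) p(2) by (simp add: mult_neg_pos)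
  have nonzero: "dd r b = (\<lambda>_. 0)" if "wt b \<noteq> 0" "valid \<Gamma> s b" for b
  proof (cases "wt b < 0")
    case False
    have "dd r (Lb (real k * - p)) = (\<lambda>_. 0)" if "k > 0" for k
      by (rule neg) (use that p multiple_mem neg_mem in auto)
    then show ?thesis
      using half[OF neg_mem[OF p(1)] _ that(2)] that(1) False p(2) by simp
  qed (use that neg in blast)
  show ?thesis
  proof (cases "wt a = 0")
    case True
    \<comment> \<open>For \<open>wt a = 0\<close> both \<open>L_m\<close> and \<open>sh m a\<close>
      have nonzero index, so the defect at \<open>a\<close> is annihilated by
      \<open>L_m\<close>.\<close>
    have *: "lact m (dd r a) = (\<lambda>_. 0)" if "m \<in> \<Gamma>" "m > 0" for m
    proof (rule ext)
      fix q
      have "dd r (Lb m) = (\<lambda>_. 0)" "dd r (sh m a) = (\<lambda>_. 0)"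
        using nonzero[of "Lb m"] nonzero[of "sh m a"] that True a by (simp_all add: valid_sh)
      then show "lact m (dd r a) q = 0"
        using dd_hom[OF r that(1) a] by simp
    qed
    show ?thesis
    proof (rule lact_invariant_zero[where p = p])
      show "lact p (dd r a) = (\<lambda>_. 0)" "lact (2 * p) (dd r a) = (\<lambda>_. 0)"
        using *[OF p] *[of "2 * p"] multiple_mem[OF p(1), of 2] p(2) by simp_all
    qed (use r a p(2) finite_spt_dd in auto)
  qed (use nonzero a in blast)
qed

lemma D_sum:
  assumes "finite S" "\<And>c. c \<in> S \<Longrightarrow> valid \<Gamma> s c"
  shows "D (\<lambda>a. \<Sum>c\<in>S. k c * bv c a) = (\<lambda>q. \<Sum>c\<in>S. k c * D (bv c) q)"
  using assms
proof (induction S)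
  case empty
  have "D (smul 0 (bv (Lb 0))) = smul 0 (D (bv (Lb 0)))"
    by (intro D_smul inL_bv) (simp add: zero_mem)
  then show ?case
    by (simp add: smul_def)
next
  case (insert c S)
  have c: "inL \<Gamma> s (bv c)"
    using insert by (simp add: inL_bv)
  have "inL \<Gamma> s (smul (k c) (bv c))"
    using c by (auto simp: inL_def spt_def smul_def intro: finite_subset)
  moreover have "inL \<Gamma> s (\<lambda>a. \<Sum>c\<in>S. k c * bv c a)"
  proof -
    have "spt (\<lambda>a. \<Sum>c\<in>S. k c * bv c a) \<subseteq> S"
      using insert(1) by (auto simp: spt_def bv_def sum.delta if_distrib cong: if_cong split: if_splits)
    then show ?thesis
      using insert unfolding inL_def by (meson finite_subset insertCI subsetD)
  qed
  ultimately have "D (\<lambda>a. smul (k c) (bv c) a + (\<Sum>c\<in>S. k c * bv c a))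
      = (\<lambda>q. D (smul (k c) (bv c)) q + D (\<lambda>a. \<Sum>c\<in>S. k c * bv c a) q)"
    by (rule D_add)
  then show ?case
    using insert D_smul[OF c, of "k c"] by (simp add: smul_def)
qed

lemma D_eq_act:
  assumes "\<And>a. valid \<Gamma> s a \<Longrightarrow> dd r a = (\<lambda>_. 0)" "inL \<Gamma> s x"
  shows "D x = act x r"
proof -
  have x: "finite (spt x)" "\<And>c. c \<in> spt x \<Longrightarrow> valid \<Gamma> s c"
    using assms(2) by (auto simp: inL_def)
  have "x = (\<lambda>a. \<Sum>c\<in>spt x. x c * bv c a)"
    using x(1) by (auto simp: bv_def spt_def sum.delta if_distrib cong: if_cong)
  then have "D x = (\<lambda>q. \<Sum>c\<in>spt x. x c * D (bv c) q)"
    using D_sum[OF x] by metis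
  also have "\<dots> = (\<lambda>q. \<Sum>c\<in>spt x. x c * act (bv c) r q)"
    using assms(1) x(2) by (intro ext sum.cong) (auto simp: dd_def fun_eq_iff)
  also have "\<dots> = act x r"
    by (simp add: act_def fun_eq_iff sum_distrib_left mult.assoc)
  finally show ?thesis .
qed

section \<open>Antisymmetry of \<open>r\<close> and the Yang-Baxter equation\<close>

lemma skew_tensor_of_im: "in_im_1_minus_tau \<Gamma> s t \<Longrightarrow> skew_tensor t"
  unfolding in_im_1_minus_tau_def skew_tensor_def
proof (elim exE conjE, intro allI)
  fix y a b
  assume "t = (\<lambda>p. y p - tau y p)"
  moreover have "ssign a b * ssign b a = 1"
    using par_cases[of a] par_cases[of b] by (auto simp: ssign_def)
  ultimately show "t (a, b) = - ssign a b * t (b, a)"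
    by (simp add: tau_def algebra_simps flip: mult.assoc)
qed

text \<open>The twist negates \<open>t\<close>, so half of \<open>t\<close> is a preimage.\<close>

lemma skew_tensor_im:
  assumes "skew_tensor t" "inL2 \<Gamma> s t"
  shows "in_im_1_minus_tau \<Gamma> s t"
  unfolding in_im_1_minus_tau_def
proof (intro exI conjI)
  show "inL2 \<Gamma> s (\<lambda>q. 1 / 2 * t q)"
    using assms(2) finite_spt_mult[of t "\<lambda>_. 1 / 2"] unfolding inL2_iff by auto
  show "t = (\<lambda>q. 1 / 2 * t q - tau (\<lambda>q. 1 / 2 * t q) q)"
  proof (rule ext, safe)
    fix a b
    have "t (a, b) = - ssign a b * t (b, a)"
      using assms(1) by (rule skew_tensorD)
    then show "t (a, b) = 1 / 2 * t (a, b) - tau (\<lambda>q. 1 / 2 * t q) (a, b)"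
      by (simp add: tau_def)
  qed
qed

text \<open>The twist commutes with \<open>L_m\<close>, and \<open>L_m\<close> carries
  \<open>r\<close> to a skew tensor; hence \<open>L_m\<close> annihilates the sum of
  \<open>r\<close> and its twist.\<close>

lemma skew_tensor_r:
  assumes r: "inL2 \<Gamma> s r" and p: "p \<in> \<Gamma>" "p > 0"
    and D: "\<And>m. m \<in> \<Gamma> \<Longrightarrow> D (bv (Lb m)) = lact m r"
  shows "skew_tensor r"
proof -
  define t where "t = (\<lambda>q. r q + ssign (fst q) (snd q) * r (snd q, fst q))"
  have fin: "finite (spt r)"
    using r by (rule inL2_finite)
  have inv: "lact m t = (\<lambda>_. 0)" if "m \<in> \<Gamma>" for m
  proof (rule ext, safe)
    fix a b
    have "skew_tensor (lact m r)"
      using D_skew[OF inL_bv, of "Lb m"] that by (simp add: D[symmetric] skew_tensor_of_im)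
    then have "lact m r (a, b) = - ssign a b * lact m r (b, a)"
      by (rule skew_tensorD)
    then show "lact m t (a, b) = 0"
      by (simp add: lact_def t_def algebra_simps eq_neg_iff_add_eq_0)
  qed
  have "t = (\<lambda>_. 0)"
  proof (rule lact_invariant_zero)
    show "finite (spt t)"
      unfolding t_def
      by (intro finite_spt_add finite_spt_mult fin finite_spt_reindex[OF fin, of "\<lambda>q. (snd q, fst q)"])
        (auto simp: inj_def)
    show "lact p t = (\<lambda>_. 0)" "lact (2 * p) t = (\<lambda>_. 0)"
      using inv p(1) multiple_mem[OF p(1), of 2] by simp_all
  qed (use p in simp)
  then show ?thesis
    unfolding skew_tensor_def t_def fun_eq_iff by (auto simp: eq_neg_iff_add_eq_0)
qed

lemma cYB_zero:
  assumes r: "inL2 \<Gamma> s r" "even_tensor r" "skew_tensor r" and p: "p \<in> \<Gamma>" "p > 0"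
    and D: "\<And>a. valid \<Gamma> s a \<Longrightarrow> D (bv a) = act (bv a) r"
  shows "cYB r = (\<lambda>_. 0)"
proof -
  have fin: "finite (spt r)"
    using r(1) by (rule inL2_finite)
  have inv: "lact3 m (cYB r) = (\<lambda>_. 0)" if m: "m \<in> \<Gamma>" for m
  proof
    fix q
    define t where "t = lact m r"
    have t: "D (bv (Lb m)) = t"
      using D[of "Lb m"] m by (simp add: t_def act_bv_Lb fin)
    have L: "inL \<Gamma> s (bv (Lb m))"
      using m by (simp add: inL_bv)
    have tt: "inL2 \<Gamma> s t" "even_tensor t" "skew_tensor t"
      using D_skew[OF L] r m unfolding t by (simp_all add: t_def inL2_lact even_tensor_lact skew_tensor_of_im)
    have fint: "finite (spt t)"
      using tt(1) by (rule inL2_finite)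
    have w: "idD D t = (\<lambda>q. C2 t r q + C3 t r q)"
      by (rule idD_eq_C[OF fint fin]) (use tt(1) D in \<open>auto simp: inL2_iff\<close>)
    have xi_add: "xi (\<lambda>q. f q + g q) = (\<lambda>q. xi f q + xi g q)" for f g
      by (auto simp: xi_def fun_eq_iff algebra_simps)
    note xi_C = xi_C1[OF r(2) tt(2) r(3) tt(3) fin fint] xi_C2[OF r(2) tt(2) r(3) tt(3) fin fint]
      xi_C3[OF tt(2) r(2) tt(3) r(3) fint fin] xi_C2[OF tt(2) r(2) tt(3) r(3) fint fin]
    \<comment> \<open>Each of \<open>C1\<close>, \<open>C2\<close>, \<open>C3\<close> occurs once at
      \<open>(t, r)\<close> and once at \<open>(r, t)\<close>: by the Leibniz rule this sum is
      \<open>L_m\<close> acting on \<open>cYB r\<close>.\<close>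
    have "C2 t r q + C3 t r q + (C1 r t q + C2 r t q) + (C3 r t q + C1 t r q) = 0"
      using D_co_jacobi[OF L, of q] unfolding t w xi_add xi_C by simp
    moreover have "lact3 m (cYB r) q = lact3 m (C1 r r) q + lact3 m (C2 r r) q + lact3 m (C3 r r) q"
      by (cases q) (simp add: lact3_def cYB_eq_C[OF fin] algebra_simps)
    ultimately show "lact3 m (cYB r) q = 0"
      by (simp add: lact3_C1 lact3_C2 lact3_C3 fin t_def[symmetric] algebra_simps)
  qed
  show ?thesis
  proof (rule lact3_invariant_zero)
    show "lact3 p (cYB r) = (\<lambda>_. 0)" "lact3 (2 * p) (cYB r) = (\<lambda>_. 0)"
      using inv p(1) multiple_mem[OF p(1), of 2] by simp_all
  qed (use p finite_spt_cYB[OF fin] in auto)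
qed

end

theorem mainTheorem2:
  fixes \<Gamma> :: "real set" and s :: real
    and D :: "(lbl \<Rightarrow> complex) \<Rightarrow> lbl \<times> lbl \<Rightarrow> complex"
  assumes "add_subgroup \<Gamma>" and "\<Gamma> \<noteq> {0}" and "2 * s \<in> \<Gamma>"
    and "lie_super_bialgebra \<Gamma> s D"
  shows "\<exists>r dr. inL2 \<Gamma> s r \<and> dr < 2 \<and> homog2 dr r \<and> in_im_1_minus_tau \<Gamma> s r
           \<and> (\<forall>x dx. inL \<Gamma> s x \<longrightarrow> dx < 2 \<longrightarrow> homog dx x \<longrightarrow>
                 D x = (\<lambda>p. (-1) ^ (dr * dx) * act x r p))
           \<and> cYB r = (\<lambda>_. 0)"
proof -
  interpret super_bialgebra \<Gamma> s D
    using assms by unfold_locales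
  obtain p0 where "p0 \<in> \<Gamma>" "p0 \<noteq> 0"
    using assms(2) zero_mem by blast
  then have "\<bar>p0\<bar> \<in> \<Gamma>" "\<bar>p0\<bar> > 0"
    using neg_mem by (auto simp: abs_if)
  then obtain p where p: "p \<in> \<Gamma>" "p > 0"
    by blast
  obtain r where r: "inL2 \<Gamma> s r" "even_tensor r" and L: "dd r (Lb 0) = (\<lambda>_. 0)"
    "dd r (Lb p) = (\<lambda>_. 0)" "dd r (Lb (2 * p)) = (\<lambda>_. 0)"
    using normalize_L1_L2[OF p] by blast
  note fin = inL2_finite[OF r(1)]
  have dd0: "dd r a = (\<lambda>_. 0)" if "valid \<Gamma> s a" for a
    using fin p L that by (rule dd_zero)
  have D: "D x = act x r" if "inL \<Gamma> s x" for x
    using dd0 that by (rule D_eq_act)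
  have "skew_tensor r"
    by (rule skew_tensor_r[OF r(1) p]) (simp add: D inL_bv act_bv_Lb fin)
  then have "in_im_1_minus_tau \<Gamma> s r" "cYB r = (\<lambda>_. 0)"
    using r p D inL_bv by (auto intro!: skew_tensor_im cYB_zero)
  \<comment> \<open>As \<open>r\<close> is even, its parity is 0 and the sign in the coboundary
    formula is trivial.\<close>
  then show ?thesis
    using r D by (intro exI[of _ r] exI[of _ 0]) (simp add: even_tensor_iff_homog2)
qed

end
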